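(* In the CONGEST model, any algorithm that solves Laplacian systems to accuracy $\epsilon\le\tfrac12$ requires at least $\widetilde{\Omega}(n^{1/2}+D)$ rounds of communication in the worst case. Here "solving a Laplacian system to accuracy $\epsilon$" means: given a weighted undirected graph $G$ (the communication network) with $n$ vertices and diameter $D$ and a vector $\vec b$ distributed over its vertices, output a vector $\vec x$ distributed over its vertices with $\|\vec x-\mathbf{L}(G)^\dagger\vec b\|_{\mathbf{L}(G)}\le\epsilon\|\vec b\|_{\mathbf{L}(G)^\dagger}$.
   Context: CONGEST model: nodes of the network have unique $O(\log n)$-bit IDs, know their neighbors and incident edge weights (positive, polynomially bounded in $n$), and communicate in synchronous rounds, each node sending an $O(\log n)$-bit message to each neighbor per round; $D$ is the unweighted diameter. $\mathbf{L}(G)$ is the weighted graph Laplacian (weighted degree matrix minus weighted adjacency matrix), $\dagger$ denotes the pseudoinverse, $\|\vec v\|_{\mathbf{M}}=\sqrt{\vec v^\top\mathbf{M}\vec v}$, and $\widetilde{\Omega}$ hides polylogarithmic factors in $n$. *)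

theory Defs
  imports "HOL-Probability.Probability" "Jordan_Normal_Form.Matrix"
begin

hide_const (open) Finite_Cartesian_Product.vec Finite_Cartesian_Product.mat
no_notation Finite_Cartesian_Product.vec_nth (infixl \<open>$\<close> 90)
no_notation Inner_Product.real_inner_class.inner (infix \<open>\<bullet>\<close> 70)

section \<open>Weighted networks\<close>

text \<open>
  The vertices are \<open>0, \<dots>, n - 1\<close>. They serve as matrix indices only: the name under which a
  node is known in the network is its identifier \<open>ident v\<close>. Weight 0 encodes the absence of an
  edge.
\<close>

record network =
  nverts :: nat
  ident :: "nat \<Rightarrow> nat"
  wt :: "nat \<Rightarrow> nat \<Rightarrow> nat"

definition adjacent :: "network \<Rightarrow> nat \<Rightarrow> nat \<Rightarrow> bool" where
  "adjacent G u v \<longleftrightarrow> u < nverts G \<and> v < nverts G \<and> wt G u v > 0"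

definition edge_rel :: "network \<Rightarrow> (nat \<times> nat) set" where
  "edge_rel G = {(u, v). adjacent G u v}"

definition hop_dist :: "network \<Rightarrow> nat \<Rightarrow> nat \<Rightarrow> nat" where
  "hop_dist G u v = (LEAST k. (u, v) \<in> edge_rel G ^^ k)"

definition diam :: "network \<Rightarrow> nat" where
  "diam G = Max {hop_dist G u v | u v. u < nverts G \<and> v < nverts G}"

text \<open>
  Identifiers and weights are polynomially bounded integers, that is, they have \<open>O(log n)\<close> bits;
  \<open>\<kappa>\<close> is the exponent of the polynomial.
\<close>

definition valid_network :: "nat \<Rightarrow> network \<Rightarrow> bool" where
  "valid_network \<kappa> G \<longleftrightarrow>
     nverts G > 0 \<and>
     inj_on (ident G) {..<nverts G} \<and>
     (\<forall>v<nverts G. ident G v < nverts G ^ \<kappa>) \<and>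
     (\<forall>u<nverts G. \<forall>v<nverts G.
        wt G u v = wt G v u \<and> wt G u v \<le> nverts G ^ \<kappa>) \<and>
     (\<forall>v<nverts G. wt G v v = 0) \<and>
     (\<forall>u<nverts G. \<forall>v<nverts G. (u, v) \<in> (edge_rel G)\<^sup>*)"

definition valid_rhs :: "nat \<Rightarrow> network \<Rightarrow> (nat \<Rightarrow> int) \<Rightarrow> bool" where
  "valid_rhs \<kappa> G b \<longleftrightarrow> (\<forall>v<nverts G. \<bar>b v\<bar> \<le> int (nverts G) ^ \<kappa>)"

section \<open>Laplacian systems\<close>

definition adjacency_mat :: "network \<Rightarrow> real mat" where
  "adjacency_mat G = mat (nverts G) (nverts G) (\<lambda>(u, v). real (wt G u v))"

definition degree_mat :: "network \<Rightarrow> real mat" where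
  "degree_mat G = mat (nverts G) (nverts G)
     (\<lambda>(u, v). if u = v then \<Sum>z<nverts G. real (wt G u z) else 0)"

definition laplacian :: "network \<Rightarrow> real mat" where
  "laplacian G = degree_mat G - adjacency_mat G"

text \<open>The four Penrose conditions, which determine the Moore--Penrose inverse uniquely.\<close>

definition is_pseudoinverse :: "real mat \<Rightarrow> real mat \<Rightarrow> bool" where
  "is_pseudoinverse M X \<longleftrightarrow>
     X \<in> carrier_mat (dim_col M) (dim_row M) \<and>
     M * X * M = M \<and> X * M * X = X \<and>
     transpose_mat (M * X) = M * X \<and> transpose_mat (X * M) = X * M"

definition pseudoinverse :: "real mat \<Rightarrow> real mat" where
  "pseudoinverse M = (THE X. is_pseudoinverse M X)"

definition mat_norm :: "real mat \<Rightarrow> real vec \<Rightarrow> real" where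
  "mat_norm M v = sqrt (v \<bullet> (M *\<^sub>v v))"

definition rhs_vec :: "network \<Rightarrow> (nat \<Rightarrow> int) \<Rightarrow> real vec" where
  "rhs_vec G b = vec (nverts G) (\<lambda>v. real_of_int (b v))"

definition laplacian_solution :: "real \<Rightarrow> network \<Rightarrow> (nat \<Rightarrow> int) \<Rightarrow> real vec \<Rightarrow> bool" where
  "laplacian_solution \<epsilon> G b x \<longleftrightarrow>
     mat_norm (laplacian G) (x - pseudoinverse (laplacian G) *\<^sub>v rhs_vec G b)
       \<le> \<epsilon> * mat_norm (pseudoinverse (laplacian G)) (rhs_vec G b)"

section \<open>The CONGEST model\<close>

text \<open>
  What a node knows initially: the number of nodes, its identifier, the identifiers of its
  neighbours with the weights of the connecting edges, and its entry of the right-hand side.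
\<close>

record local_input =
  net_size :: nat
  own_id :: nat
  nbrs :: "(nat \<times> nat) set"
  own_rhs :: int

type_synonym message = "bool list"

text \<open>
  The messages received by a node, tagged with the sender's identifier, one set per past round.
\<close>

type_synonym history = "(nat \<times> message) set list"

text \<open>An infinite string of private random bits.\<close>

type_synonym coins = "nat \<Rightarrow> bool"

text \<open>
  A node's state is its entire history, so local computation is unrestricted. The message sent in
  a round may depend on the (identifier of the) neighbour that receives it. \<open>outp\<close> returns \<open>None\<close>
  as long as the node has not yet settled on its output.
\<close>

record algorithm =
  send :: "local_input \<Rightarrow> coins \<Rightarrow> history \<Rightarrow> nat \<Rightarrow> message"
  outp :: "local_input \<Rightarrow> coins \<Rightarrow> history \<Rightarrow> real option"

text \<open>\<open>\<beta>\<close> is the constant hidden in the message length \<open>O(log n)\<close>.\<close>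

definition congest :: "real \<Rightarrow> algorithm \<Rightarrow> bool" where
  "congest \<beta> A \<longleftrightarrow>
     (\<forall>l c h i. real (length (send A l c h i)) \<le> \<beta> * log 2 (real (net_size l)))"

definition local_of :: "network \<Rightarrow> (nat \<Rightarrow> int) \<Rightarrow> nat \<Rightarrow> local_input" where
  "local_of G b v =
     \<lparr>net_size = nverts G, own_id = ident G v,
      nbrs = {(ident G u, wt G u v) | u. adjacent G u v}, own_rhs = b v\<rparr>"

fun hist :: "algorithm \<Rightarrow> network \<Rightarrow> (nat \<Rightarrow> int) \<Rightarrow> (nat \<Rightarrow> coins) \<Rightarrow> nat \<Rightarrow> nat \<Rightarrow> history" where
  "hist A G b \<omega> 0 v = []"
| "hist A G b \<omega> (Suc t) v = hist A G b \<omega> t v @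
     [{(ident G u, send A (local_of G b u) (\<omega> u) (hist A G b \<omega> t u) (ident G v)) | u.
        adjacent G u v}]"

definition outp_at ::
  "algorithm \<Rightarrow> network \<Rightarrow> (nat \<Rightarrow> int) \<Rightarrow> (nat \<Rightarrow> coins) \<Rightarrow> nat \<Rightarrow> nat \<Rightarrow> real option" where
  "outp_at A G b \<omega> t v = outp A (local_of G b v) (\<omega> v) (hist A G b \<omega> t v)"

definition finishes_within ::
  "algorithm \<Rightarrow> network \<Rightarrow> (nat \<Rightarrow> int) \<Rightarrow> (nat \<Rightarrow> coins) \<Rightarrow> nat \<Rightarrow> bool" where
  "finishes_within A G b \<omega> r \<longleftrightarrow> (\<forall>v<nverts G. \<exists>t\<le>r. outp_at A G b \<omega> t v \<noteq> None)"

text \<open>A node's first output is final.\<close>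

definition result ::
  "algorithm \<Rightarrow> network \<Rightarrow> (nat \<Rightarrow> int) \<Rightarrow> (nat \<Rightarrow> coins) \<Rightarrow> real vec" where
  "result A G b \<omega> = vec (nverts G)
     (\<lambda>v. the (outp_at A G b \<omega> (LEAST t. outp_at A G b \<omega> t v \<noteq> None) v))"

definition coin_measure :: "(nat \<Rightarrow> coins) measure" where
  "coin_measure = Pi\<^sub>M UNIV (\<lambda>_. Pi\<^sub>M UNIV (\<lambda>_. measure_pmf (bernoulli_pmf (1/2))))"

text \<open>
  \<open>T n D\<close> bounds the number of rounds on every input with \<open>n\<close> vertices and diameter \<open>D\<close>. Algorithms
  may be randomized with success probability 2/3; deterministic ones ignore their coins. As
  \<open>send\<close> and \<open>outp\<close> are arbitrary functions of the coins, the set of successful outcomes need not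
  be measurable; it is required to contain a measurable set of probability 2/3.
\<close>

definition solves_laplacian_within ::
  "nat \<Rightarrow> real \<Rightarrow> algorithm \<Rightarrow> (nat \<Rightarrow> nat \<Rightarrow> nat) \<Rightarrow> bool" where
  "solves_laplacian_within \<kappa> \<epsilon> A T \<longleftrightarrow>
     (\<forall>G b. valid_network \<kappa> G \<and> valid_rhs \<kappa> G b \<longrightarrow>
        (\<exists>S\<in>sets coin_measure. measure coin_measure S \<ge> 2/3 \<and>
           (\<forall>\<omega>\<in>S. finishes_within A G b \<omega> (T (nverts G) (diam G)) \<and>
                  laplacian_solution \<epsilon> G b (result A G b \<omega>))))"

end

theory Submission
  imports Defs "Jordan_Normal_Form.Determinant"
begin

text \<open>
  Only the right-hand side carries information. Fix the coins by averaging, and let a family of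
  right-hand sides differ only on a set of vertices far from a \<^emph>\<open>target\<close> set that carries
  most of the energy of the solution. An approximation in the \<open>L\<close>-norm then has to reveal, on the
  target alone, most of the bits that define the right-hand side.

  If \<open>D \<ge> sqrt n\<close>, the network is a path with a light middle edge, with right-hand side \<open>\<plusminus>D\<close> at its
  two ends: fewer than \<open>D/2 - 1\<close> rounds do not bring the sign to the middle.

  If \<open>D < sqrt n\<close>, the network consists of \<open>2m\<close> parallel rows with \<open>2 ^ h \<approx> sqrt n\<close> columns, and of
  a binary tree with one leaf per column, which is joined to all rows in that column. The rows come in
  pairs that get opposite currents \<open>\<plusminus>s\<^sub>i\<close> in column 0; by antisymmetry the tree stays at potential
  0, the rows decouple, and the edge weights are chosen so that the potential is linear along each row
  and most of the energy sits in the last column. Information reaches the last column in fewer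
  than \<open>2 ^ h - 1\<close> rounds only through the tree, where at most \<open>h\<close> messages per round enter the region
  still unaffected. Hence the outputs in the last column take at most \<open>2 ^ O(T log\<^sup>2 n)\<close> values, and each
  of them is compatible with at most a Hamming ball of radius \<open>m/3\<close> of sign patterns. A tail and
  pendant vertices at the root adjust \<open>D\<close> and \<open>n\<close>.
\<close>

section \<open>Laplacian systems\<close>

text \<open>\<open>M * X = (M * Y) * (M * X)\<close> is a product of symmetric matrices; transposing
  swaps the factors, and the product collapses to \<open>M * Y\<close>. Likewise
  \<open>X * M = Y * M\<close>, which turns \<open>X * M * X\<close> into \<open>Y\<close>.\<close>

lemma pseudoinverse_unique:
  assumes X: "is_pseudoinverse M X" and Y: "is_pseudoinverse M Y"
  shows "X = Y"
proof -
  define r c where "r = dim_row M" and "c = dim_col M"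
  have M [simp]: "M \<in> carrier_mat r c" and Xc [simp]: "X \<in> carrier_mat c r"
      and Yc [simp]: "Y \<in> carrier_mat c r"
    using X Y by (auto simp: is_pseudoinverse_def r_def c_def)
  have X1: "M * X * M = M" and X2: "X * M * X = X"
    and X3: "(M * X)\<^sup>T = M * X" and X4: "(X * M)\<^sup>T = X * M"
    using X by (auto simp: is_pseudoinverse_def)
  have Y1: "M * Y * M = M" and Y2: "Y * M * Y = Y"
    and Y3: "(M * Y)\<^sup>T = M * Y" and Y4: "(Y * M)\<^sup>T = Y * M"
    using Y by (auto simp: is_pseudoinverse_def)
  have MX [simp]: "M * X \<in> carrier_mat r r" and MY [simp]: "M * Y \<in> carrier_mat r r"
    and XM [simp]: "X * M \<in> carrier_mat c c" and YM [simp]: "Y * M \<in> carrier_mat c c"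
    by (rule mult_carrier_mat[where n = c] mult_carrier_mat[where n = r], simp, simp)+
  have "M * X = (M * Y * M) * X" by (simp only: Y1)
  also have "\<dots> = (M * Y) * (M * X)" by (rule assoc_mult_mat[of _ r r _ c _ r]) simp_all
  finally have "M * X = ((M * Y) * (M * X))\<^sup>T" using X3 by simp
  also have "\<dots> = (M * X) * (M * Y)"
    by (subst transpose_mult[of _ r r _ r]) (simp_all only: X3 Y3 MX MY)
  also have "\<dots> = (M * X * M) * Y" by (rule assoc_mult_mat[symmetric, of _ r r _ c _ r]) simp_all
  finally have eq1: "M * X = M * Y" by (simp only: X1)
  have "X * M = X * (M * Y * M)" by (simp only: Y1)
  also have "\<dots> = X * (M * (Y * M))" by (simp only: assoc_mult_mat[of M r c Y r M c] M Yc)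
  also have "\<dots> = (X * M) * (Y * M)" by (rule assoc_mult_mat[symmetric, of _ c r _ c _ c]) simp_all
  finally have "X * M = ((X * M) * (Y * M))\<^sup>T" using X4 by simp
  also have "\<dots> = (Y * M) * (X * M)"
    by (subst transpose_mult[of _ c c _ c]) (simp_all only: X4 Y4 XM YM)
  also have "\<dots> = Y * (M * (X * M))" by (rule assoc_mult_mat[of _ c r _ c _ c]) simp_all
  also have "\<dots> = Y * (M * X * M)" by (simp only: assoc_mult_mat[of M r c X r M c] M Xc)
  finally have eq2: "X * M = Y * M" by (simp only: X1)
  have "X = (X * M) * X" by (simp only: X2)
  also have "\<dots> = Y * (M * X)" unfolding eq2 by (rule assoc_mult_mat[of _ c r _ c _ r]) simp_all
  also have "\<dots> = (Y * M) * Y" unfolding eq1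
      by (rule assoc_mult_mat[symmetric, of _ c r _ c _ r]) simp_all
  finally show ?thesis by (simp only: Y2)
qed

lemma laplacian_carrier [simp]: "laplacian G \<in> carrier_mat (nverts G) (nverts G)"
  by (auto simp: laplacian_def degree_mat_def adjacency_mat_def)

lemma transpose_laplacian:
  assumes "valid_network \<kappa> G"
  shows "(laplacian G)\<^sup>T = laplacian G"
  using assms by (intro eq_matI) (auto
    simp: laplacian_def degree_mat_def adjacency_mat_def valid_network_def)

lemma laplacian_mult_vec:
  assumes "v < nverts G" "dim_vec y = nverts G"
  shows "(laplacian G *\<^sub>v y) $ v = (\<Sum>u<nverts G. real (wt G v u) * (y $ v - y $ u))"
proof -
  have "(laplacian G *\<^sub>v y) $ v = (\<Sum>u<nverts G.
      ((if v = u then \<Sum>z<nverts G. real (wt G v z) else 0) - real (wt G v u)) * y $ u)"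
    using assms
      by (simp add: laplacian_def degree_mat_def adjacency_mat_def scalar_prod_def atLeast0LessThan)
  also have "\<dots> = (\<Sum>u<nverts G. (if v = u then (\<Sum>z<nverts G. real (wt G v z)) * y $ u else 0)
      - real (wt G v u) * y $ u)"
    by (intro sum.cong) (auto simp: algebra_simps)
  also have "\<dots> = (\<Sum>z<nverts G. real (wt G v z)) * y $ v - (\<Sum>u<nverts G. real (wt G v u) * y $ u)"
    using assms by (simp add: sum_subtractf)
  finally show ?thesis
    by (simp add: sum_distrib_right sum_subtractf right_diff_distrib)
qed

text \<open>Symmetric weights let the two endpoints be exchanged; averaging both versions completes
  the square. The double sum meets every edge in both orders, hence the division by 2.\<close>

lemma laplacian_form:
  assumes G: "valid_network \<kappa> G" and y: "dim_vec y = nverts G"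
  shows "y \<bullet> (laplacian G *\<^sub>v y) =
    (\<Sum>u<nverts G. \<Sum>v<nverts G. real (wt G u v) * (y $ u - y $ v)\<^sup>2) / 2"
proof -
  let ?n = "nverts G"
  have sym: "wt G u v = wt G v u" if "u < ?n" "v < ?n" for u v
    using G that by (auto simp: valid_network_def)
  have "y \<bullet> (laplacian G *\<^sub>v y) = (\<Sum>u<?n. y $ u * (laplacian G *\<^sub>v y) $ u)"
    by (simp add: scalar_prod_def atLeast0LessThan laplacian_def adjacency_mat_def)
  also have "\<dots> = (\<Sum>u<?n. \<Sum>v<?n. real (wt G u v) * (y $ u - y $ v) * y $ u)"
    by (intro sum.cong refl) (simp add: laplacian_mult_vec y sum_distrib_left mult_ac del: index_mult_mat_vec)
  finally have 1: "y \<bullet> (laplacian G *\<^sub>v y) = (\<Sum>u<?n. \<Sum>v<?n. real (wt G u v) * (y $ u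
      - y $ v) * y $ u)" .
  also have "\<dots> = (\<Sum>u<?n. \<Sum>v<?n. real (wt G u v) * (y $ v - y $ u) * y $ v)"
    by (subst sum.swap) (intro sum.cong refl, auto simp: sym)
  finally have 2: "y \<bullet> (laplacian G *\<^sub>v y) = (\<Sum>u<?n. \<Sum>v<?n. real (wt G u v) * (y $ v
      - y $ u) * y $ v)" .
  have "2 * (y \<bullet> (laplacian G *\<^sub>v y)) = (\<Sum>u<?n. \<Sum>v<?n. real (wt G u v) * (y $ u - y $ v) * y $ u)
      + (\<Sum>u<?n. \<Sum>v<?n. real (wt G u v) * (y $ v - y $ u) * y $ v)"
    using 1 2 by simp
  also have "\<dots> = (\<Sum>u<?n. \<Sum>v<?n. real (wt G u v) * (y $ u - y $ v)\<^sup>2)"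
    by (simp add: sum.distrib[symmetric] power2_eq_square algebra_simps)
  finally show ?thesis by simp
qed

text \<open>Zero energy leaves no drop across any edge, and connectedness spreads this to all pairs.
  In particular the kernel of the Laplacian contains only constant vectors.\<close>

lemma laplacian_form_eq_0_imp_const:
  assumes G: "valid_network \<kappa> G" and y: "dim_vec y = nverts G"
    and 0: "y \<bullet> (laplacian G *\<^sub>v y) = 0" and uv: "u < nverts G" "v < nverts G"
  shows "y $ u = y $ v"
proof -
  have s: "(\<Sum>u<nverts G. \<Sum>v<nverts G. real (wt G u v) * (y $ u - y $ v)\<^sup>2) = 0"
    using 0 laplacian_form[OF G y] by simp
  have edge: "y $ a = y $ b" if "(a, b) \<in> edge_rel G" for a b
  proof -
    have ab: "a < nverts G" "b < nverts G" "wt G a b > 0" using that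
        by (auto simp: edge_rel_def adjacent_def)
    have "\<forall>a\<in>{..<nverts G}. (\<Sum>v<nverts G. real (wt G a v) * (y $ a - y $ v)\<^sup>2) = 0"
      using s by (subst (asm) sum_nonneg_eq_0_iff) (auto intro!: sum_nonneg)
    then have "(\<Sum>v<nverts G. real (wt G a v) * (y $ a - y $ v)\<^sup>2) = 0" using ab by auto
    then have "\<forall>v\<in>{..<nverts G}. real (wt G a v) * (y $ a - y $ v)\<^sup>2 = 0"
      by (subst (asm) sum_nonneg_eq_0_iff) auto
    then show ?thesis using ab by (auto simp: Ball_def)
  qed
  have "(u, v) \<in> (edge_rel G)\<^sup>*" using G uv by (auto simp: valid_network_def)
  then show ?thesis by (induction rule: rtrancl_induct) (auto dest: edge)
qed

text \<open>
  For a connected network \<open>J = 1 1\<^sup>T / n\<close> is the projection onto the kernel of \<open>L\<close>, so that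
  \<open>L + J\<close> is invertible and the pseudoinverse is \<open>(L + J)\<inverse> - J\<close>.
\<close>

lemma is_pseudoinverse_laplacian:
  assumes G: "valid_network \<kappa> G"
  shows "is_pseudoinverse (laplacian G) (pseudoinverse (laplacian G))"
proof -
  define n where "n = nverts G"
  define L where "L = laplacian G"
  define J where "J = mat n n (\<lambda>_. 1 / real n :: real)"
  have n: "n > 0" using G by (simp add: valid_network_def n_def)
  have L [simp]: "L \<in> carrier_mat n n" and J [simp]: "J \<in> carrier_mat n n"
    by (auto simp: L_def J_def n_def)
  have dL [simp]: "dim_row L = n" "dim_col L = n" and dJ [simp]: "dim_row J = n" "dim_col J = n"
    using L J by (blast dest: carrier_matD)+
  have LT: "L\<^sup>T = L" unfolding L_def by (rule transpose_laplacian[OF G])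
  have JT: "J\<^sup>T = J" by (rule eq_matI) (auto simp: J_def)
  have JJ: "J * J = J"
    using n by (intro eq_matI) (auto simp: J_def scalar_prod_def)
  have LJ: "L * J = 0\<^sub>m n n"
  proof (rule eq_matI)
    fix i j assume "i < dim_row (0\<^sub>m n n :: real mat)" "j < dim_col (0\<^sub>m n n :: real mat)"
    then have ij: "i < n" "j < n" by auto
    have "(L * J) $$ (i, j) = (L *\<^sub>v col J j) $ i" using ij by simp
    also have "\<dots> = 0" using ij unfolding L_def
      by (subst laplacian_mult_vec) (auto simp: n_def[symmetric] J_def)
    finally show "(L * J) $$ (i, j) = 0\<^sub>m n n $$ (i, j)" using ij by simp
  qed auto
  have "J * L = (L * J)\<^sup>T" by (subst transpose_mult[of _ n n _ n]) (simp_all add: LT JT)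
  then have JL: "J * L = 0\<^sub>m n n" by (simp add: LJ)
  define M where "M = L + J"
  have M [simp]: "M \<in> carrier_mat n n" by (simp add: M_def)
  \<comment> \<open>For a kernel vector \<open>v\<close>, the form of \<open>M\<close> is the energy
    of \<open>v\<close> plus its squared entry sum over \<open>n\<close>. The first term makes
    \<open>v\<close> constant, the second makes the constant 0.\<close>
  have "det M \<noteq> 0"
  proof
    assume "det M = 0"
    then obtain v where v: "v \<in> carrier_vec n" "v \<noteq> 0\<^sub>v n" "M *\<^sub>v v = 0\<^sub>v n"
      using det_0_iff_vec_prod_zero[OF M] by auto
    have vd: "dim_vec v = n" using v by auto
    have "0 = v \<bullet> (M *\<^sub>v v)" using v by simp
    also have "M *\<^sub>v v = L *\<^sub>v v + J *\<^sub>v v" unfolding M_def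
      by (rule add_mult_distrib_mat_vec[of _ n n]) (use v in auto)
    also have "v \<bullet> \<dots> = v \<bullet> (L *\<^sub>v v) + v \<bullet> (J *\<^sub>v v)"
      by (rule scalar_prod_add_distrib[of _ n]) (use v in \<open>auto intro!: mult_mat_vec_carrier\<close>)
    also have "v \<bullet> (J *\<^sub>v v) = (\<Sum>i<n. v $ i * ((\<Sum>j<n. v $ j) / n))"
      using vd by (simp add: scalar_prod_def J_def atLeast0LessThan sum_divide_distrib)
    also have "\<dots> = (\<Sum>i<n. v $ i)\<^sup>2 / n"
      by (subst sum_distrib_right[symmetric]) (simp add: power2_eq_square)
    finally have "v \<bullet> (L *\<^sub>v v) + (\<Sum>i<n. v $ i)\<^sup>2 / n = 0" by simp
    moreover have "v \<bullet> (L *\<^sub>v v) \<ge> 0"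
      unfolding L_def using vd by (subst laplacian_form[OF G]) (auto simp: n_def intro!: sum_nonneg)
    moreover have "(\<Sum>i<n. v $ i)\<^sup>2 / n \<ge> 0" by simp
    ultimately have z: "v \<bullet> (L *\<^sub>v v) = 0" "(\<Sum>i<n. v $ i)\<^sup>2 / n = 0" by linarith+
    have c: "v $ i = v $ 0" if "i < n" for i
      using laplacian_form_eq_0_imp_const[OF G, of v i 0] z(1) that n vd by (auto simp: L_def n_def)
    have "(\<Sum>i<n. v $ i) = (\<Sum>i<n. v $ 0)" by (rule sum.cong) (auto intro: c)
    then have "v $ 0 = 0" using z(2) n by simp
    then have "v $ i = 0" if "i < n" for i using c[OF that] by simp
    then have "v = 0\<^sub>v n" using vd by (intro eq_vecI) auto
    with v show False by simp
  qed
  from det_non_zero_imp_unit[OF M this, where b = "()"]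
  obtain N where N [simp]: "N \<in> carrier_mat n n" and NM: "N * M = 1\<^sub>m n" and MN: "M * N = 1\<^sub>m n"
    by (auto simp: Units_def ring_mat_def)
  define X where "X = N - J"
  have X [simp]: "X \<in> carrier_mat n n" unfolding X_def by (rule minus_carrier_mat) simp
  have dX [simp]: "dim_row X = n" "dim_col X = n" using X by (blast dest: carrier_matD)+
  have MJ: "M * J = J" unfolding M_def
    by (subst add_mult_distrib_mat[of _ n n _ _ n]) (simp_all add: LJ JJ)
  have JM: "J * M = J" unfolding M_def
    by (subst mult_add_distrib_mat[of _ n n _ n]) (simp_all add: JL JJ)
  have "N * J = N * (M * J)" by (simp add: MJ)
  also have "\<dots> = (N * M) * J" by (rule assoc_mult_mat[symmetric, of _ n n _ n _ n]) simp_all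
  finally have NJ: "N * J = J" by (simp add: NM)
  have "J * N = (J * M) * N" by (simp add: JM)
  also have "\<dots> = J * (M * N)" by (rule assoc_mult_mat[of _ n n _ n _ n]) simp_all
  finally have JN: "J * N = J" by (simp add: MN)
  have LMJ: "L = M - J" by (rule eq_matI) (auto simp: M_def)
  \<comment> \<open>Both products are the same symmetric projection; with \<open>J * L = 0\<close>
    and \<open>J * X = 0\<close> this yields all Penrose conditions.\<close>
  have LX: "L * X = 1\<^sub>m n - J"
  proof -
    have "L * X = L * N - L * J" unfolding X_def
        by (rule mult_minus_distrib_mat[of _ n n _ n]) simp_all
    also have "L * N = 1\<^sub>m n - J" unfolding LMJ
      by (subst minus_mult_distrib_mat[of _ n n _ _ n]) (simp_all add: MN JN)
    finally show ?thesis unfolding LJ by (intro eq_matI) auto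
  qed
  have XL: "X * L = 1\<^sub>m n - J"
  proof -
    have "X * L = N * L - J * L" unfolding X_def
        by (rule minus_mult_distrib_mat[of _ n n _ _ n]) simp_all
    also have "N * L = 1\<^sub>m n - J" unfolding LMJ
      by (subst mult_minus_distrib_mat[of _ n n _ n]) (simp_all add: NM NJ)
    finally show ?thesis unfolding JL by (intro eq_matI) auto
  qed
  have JX: "J * X = 0\<^sub>m n n" unfolding X_def
    by (subst mult_minus_distrib_mat[of _ n n _ n]) (simp_all add: JN JJ)
  have "is_pseudoinverse L X" unfolding is_pseudoinverse_def
  proof (intro conjI)
    show "L * X * L = L" unfolding LX
      by (subst minus_mult_distrib_mat[of _ n n _ _ n]) (simp_all add: JL left_mult_one_mat[of _ n n], intro eq_matI, auto)
    show "X * L * X = X" unfolding XL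
      by (subst minus_mult_distrib_mat[of _ n n _ _ n]) (simp_all add: JX left_mult_one_mat[of _ n n], intro eq_matI, auto)
    show "(L * X)\<^sup>T = L * X" "(X * L)\<^sup>T = X * L" unfolding LX XL
      by (subst transpose_minus[of _ n n]; simp add: JT)+
  qed simp
  then show ?thesis unfolding pseudoinverse_def L_def[symmetric]
    using pseudoinverse_unique by (intro theI[of "is_pseudoinverse L" X]) auto
qed

text \<open>
  Both sides of the accuracy requirement depend on \<open>b\<close> only through an arbitrary preimage \<open>y\<close> of
  \<open>b\<close> under \<open>L\<close>: they are \<open>\<parallel>x - y\<parallel>\<^sub>L\<close> and \<open>\<epsilon> \<parallel>y\<parallel>\<^sub>L\<close>, where \<open>\<parallel>y\<parallel>\<^sub>L\<^sup>2 = y \<bullet> b\<close>.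
\<close>

lemma laplacian_solution_energy:
  fixes y :: "nat \<Rightarrow> real"
  assumes G: "valid_network \<kappa> G"
    and y: "\<And>v. v < nverts G \<Longrightarrow> (\<Sum>u<nverts G. real (wt G v u) * (y v - y u)) = b v"
    and x: "dim_vec x = nverts G" and sol: "laplacian_solution \<epsilon> G b x" and eps: "\<epsilon> \<le> 1/2"
  shows "(\<Sum>u<nverts G. \<Sum>v<nverts G. real (wt G u v) * ((x $ u - y u) - (x $ v - y v))\<^sup>2)
    \<le> (\<Sum>v<nverts G. y v * b v) / 2"
proof -
  define n where "n = nverts G"
  define L where "L = laplacian G"
  define X where "X = pseudoinverse L"
  define Y where "Y = vec n y"
  define B where "B = rhs_vec G b"
  have L [simp]: "L \<in> carrier_mat n n" by (simp add: L_def n_def)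
  have P: "is_pseudoinverse L X" using is_pseudoinverse_laplacian[OF G] by (simp add: L_def X_def)
  have dL: "dim_row L = n" "dim_col L = n" using L by (blast dest: carrier_matD)+
  have X [simp]: "X \<in> carrier_mat n n" using P by (simp add: is_pseudoinverse_def dL)
  have dX: "dim_row X = n" "dim_col X = n" using X by (blast dest: carrier_matD)+
  have LXL: "L * X * L = L" using P by (simp add: is_pseudoinverse_def)
  have Y [simp]: "Y \<in> carrier_vec n" by (simp add: Y_def)
  have B [simp]: "B \<in> carrier_vec n" by (simp add: B_def rhs_vec_def n_def)
  have xc [simp]: "x \<in> carrier_vec n" using x by (auto simp: n_def intro: carrier_vecI)
  have LY: "L *\<^sub>v Y = B"
  proof (rule eq_vecI)
    fix i assume "i < dim_vec B"
    then have i: "i < nverts G" by (simp add: B_def rhs_vec_def)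
    show "(L *\<^sub>v Y) $ i = B $ i" unfolding L_def
      by (subst laplacian_mult_vec[OF i]) (use i y[OF i] in \<open>auto
        simp: Y_def n_def B_def rhs_vec_def\<close>)
  qed (simp add: dL B_def rhs_vec_def n_def)
  define E where "E = x - X *\<^sub>v B"
  have XB [simp]: "X *\<^sub>v B \<in> carrier_vec n" by (rule mult_mat_vec_carrier[of _ n n]) simp_all
  have E [simp]: "E \<in> carrier_vec n" by (simp add: E_def)
  have LXB: "L *\<^sub>v (X *\<^sub>v B) = L *\<^sub>v Y"
  proof -
    have "L *\<^sub>v (X *\<^sub>v B) = (L * X * L) *\<^sub>v Y"
      unfolding LY[symmetric]
      by (metis L X Y assoc_mult_mat_vec mult_carrier_mat mult_mat_vec_carrier)
    then show ?thesis by (simp only: LXL)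
  qed
  \<comment> \<open>\<open>Z\<close> lies in the kernel of \<open>L\<close>, so it is constant:
    replacing the exact solution by \<open>y\<close> changes no difference between two
    vertices.\<close>
  define Z where "Z = X *\<^sub>v B - Y"
  have Z [simp]: "Z \<in> carrier_vec n" by (simp add: Z_def)
  have "L *\<^sub>v Z = 0\<^sub>v n"
    unfolding Z_def by (subst mult_minus_distrib_mat_vec[of _ n n]) (simp_all add: LXB LY)
  then have ZZ: "Z \<bullet> (laplacian G *\<^sub>v Z) = 0" by (simp add: L_def[symmetric])
  have Zc: "Z $ u = Z $ v" if "u < n" "v < n" for u v
    by (rule laplacian_form_eq_0_imp_const[OF G, of Z])
      (use ZZ that in \<open>auto simp: n_def[symmetric] Z_def Y_def\<close>)
  have Ed: "E $ u - E $ v = (x $ u - y u) - (x $ v - y v)" if "u < n" "v < n" for u v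
    using Zc[OF that] that unfolding E_def Z_def
    by (simp add: dX Y_def del: index_mult_mat_vec)
  have "E \<bullet> (L *\<^sub>v E) = (\<Sum>u<n. \<Sum>v<n. real (wt G u v) * (E $ u - E $ v)\<^sup>2) / 2"
    unfolding L_def n_def by (rule laplacian_form[OF G]) (simp add: n_def[symmetric])
  also have "\<dots> = (\<Sum>u<n. \<Sum>v<n. real (wt G u v) * ((x $ u - y u) - (x $ v - y v))\<^sup>2) / 2"
    by (simp add: Ed)
  finally have EE: "E \<bullet> (L *\<^sub>v E) = \<dots>" .
  have "B \<bullet> (X *\<^sub>v B) = (L *\<^sub>v Y) \<bullet> (X *\<^sub>v B)" by (simp add: LY)
  also have "\<dots> = (L\<^sup>T *\<^sub>v Y) \<bullet> (X *\<^sub>v B)" by (simp add: L_def transpose_laplacian[OF G])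
  also have "\<dots> = Y \<bullet> (L *\<^sub>v (X *\<^sub>v B))"
    by (rule transpose_vec_mult_scalar[of _ n n]) simp_all
  also have "\<dots> = Y \<bullet> B" by (simp add: LXB LY)
  finally have BX: "B \<bullet> (X *\<^sub>v B) = Y \<bullet> B" .
  have YB: "Y \<bullet> B = (\<Sum>v<n. y v * b v)"
    by (simp add: scalar_prod_def Y_def B_def rhs_vec_def n_def atLeast0LessThan)
  have "Y \<bullet> (L *\<^sub>v Y) \<ge> 0"
    unfolding L_def by (subst laplacian_form[OF G]) (auto simp: Y_def n_def intro!: sum_nonneg)
  then have YB0: "Y \<bullet> B \<ge> 0" by (simp add: LY)
  have "sqrt (E \<bullet> (L *\<^sub>v E)) \<le> \<epsilon> * sqrt (Y \<bullet> B)"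
    using sol by (simp add: laplacian_solution_def mat_norm_def L_def[symmetric] X_def[symmetric]
        B_def[symmetric] E_def[symmetric] BX)
  also have "\<dots> \<le> 1/2 * sqrt (Y \<bullet> B)" using eps YB0 by (intro mult_right_mono) auto
  also have "\<dots> = sqrt (Y \<bullet> B / 4)" by (simp add: real_sqrt_divide)
  \<comment> \<open>Squaring turns 1/2 into 1/4; the double sum of the conclusion is twice the form,
    which gives 1/2 again.\<close>
  finally have "E \<bullet> (L *\<^sub>v E) \<le> Y \<bullet> B / 4" by simp
  then show ?thesis by (simp add: EE YB n_def)
qed

section \<open>Information flow into a shrinking region\<close>

text \<open>\<open>R t\<close> is meant as the set of vertices unaffected after \<open>t\<close>
  rounds. Only a message from a sender outside \<open>R t\<close> can bring news to a vertex that is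
  to stay in \<open>R (Suc t)\<close>.\<close>

definition crossing :: "network \<Rightarrow> (nat \<Rightarrow> nat set) \<Rightarrow> nat \<Rightarrow> (nat \<times> nat \<times> nat) set" where
  "crossing G R T = {(t, u, v). t < T \<and> adjacent G u v \<and> v \<in> R (Suc t) \<and> u \<notin> R t}"

text \<open>Restricting to the crossings makes equality of transcripts mean equality of exactly
  these messages, and puts the transcripts into a finite extensional function space.\<close>

definition transcript ::
  "algorithm \<Rightarrow> network \<Rightarrow> (nat \<Rightarrow> nat set) \<Rightarrow> (nat \<Rightarrow> coins) \<Rightarrow> nat \<Rightarrow> (nat \<Rightarrow> int)
    \<Rightarrow> nat \<times> nat \<times> nat \<Rightarrow> message" where
  "transcript A G R \<omega> T b = restrict (\<lambda>(t, u, v).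
     send A (local_of G b u) (\<omega> u) (hist A G b \<omega> t u) (ident G v)) (crossing G R T)"

text \<open>A neighbour inside \<open>R t\<close> has the same history in both runs by induction,
  hence sends the same message; a message from outside \<open>R t\<close> is recorded in the
  transcript.\<close>

lemma hist_eq_if_transcript_eq:
  assumes R: "\<And>t. t < T \<Longrightarrow> R (Suc t) \<subseteq> R t"
    and b: "\<And>v. v \<in> R 0 \<Longrightarrow> b v = b' v"
    and eq: "transcript A G R \<omega> T b = transcript A G R \<omega> T b'"
    and t: "t \<le> T" and v: "v \<in> R t"
  shows "hist A G b \<omega> t v = hist A G b' \<omega> t v"
  using t v
proof (induction t arbitrary: v)
  case (Suc t)
  have R0: "R s \<subseteq> R 0" if "s \<le> T" for s
    using that
  proof (induction s)
    case (Suc s)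
    then show ?case using R[of s] by auto
  qed simp
  have snd: "send A (local_of G b u) (\<omega> u) (hist A G b \<omega> t u) (ident G v) =
      send A (local_of G b' u) (\<omega> u) (hist A G b' \<omega> t u) (ident G v)" if "adjacent G u v" for u
  proof (cases "u \<in> R t")
    case True
    then have "b u = b' u" using R0[of t] Suc.prems(1) b by auto
    then show ?thesis using Suc.IH[of u] True Suc.prems(1) by (simp add: local_of_def)
  next
    case False
    then have "(t, u, v) \<in> crossing G R T" using that Suc.prems by (simp add: crossing_def)
    then show ?thesis using fun_cong[OF eq, of "(t, u, v)"] by (simp add: transcript_def)
  qed
  have "hist A G b \<omega> t v = hist A G b' \<omega> t v" using Suc R[of t] by auto
  then show ?case using snd by (auto intro!: Collect_cong ex_cong1)
qed simp

text \<open>The outputs agree at all times up to \<open>T\<close>, and the first output falls into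
  this period, so its time and its value are the same in both runs.\<close>

lemma result_eq_if_transcript_eq:
  assumes R: "\<And>t. t < T \<Longrightarrow> R (Suc t) \<subseteq> R t"
    and b: "\<And>v. v \<in> R 0 \<Longrightarrow> b v = b' v"
    and eq: "transcript A G R \<omega> T b = transcript A G R \<omega> T b'"
    and v: "v \<in> R T" "v < nverts G"
    and fin: "finishes_within A G b \<omega> T" "finishes_within A G b' \<omega> T"
  shows "result A G b \<omega> $ v = result A G b' \<omega> $ v"
proof -
  have RT: "R T \<subseteq> R t" if "t \<le> T" for t
    using that
  proof (induction rule: inc_induct)
    case (step t)
    then show ?case using R[of t] by auto
  qed simp
  have bv: "b v = b' v" using RT[of 0] v b by auto
  have out: "outp_at A G b \<omega> t v = outp_at A G b' \<omega> t v" if "t \<le> T" for t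
    using hist_eq_if_transcript_eq[OF R b eq that, of v] RT[OF that] v bv
    by (auto simp: outp_at_def local_of_def)
  obtain t where t: "t \<le> T" "outp_at A G b \<omega> t v \<noteq> None"
    using fin v by (auto simp: finishes_within_def)
  define s where "s = (LEAST t. outp_at A G b \<omega> t v \<noteq> None)"
  have s: "outp_at A G b \<omega> s v \<noteq> None" "s \<le> t"
    unfolding s_def by (rule LeastI[of "\<lambda>t. outp_at A G b \<omega> t v \<noteq> None", OF t(2)])
      (rule Least_le[of "\<lambda>t. outp_at A G b \<omega> t v \<noteq> None", OF t(2)])
  have "(LEAST t. outp_at A G b' \<omega> t v \<noteq> None) = s"
  proof (rule Least_equality)
    show "outp_at A G b' \<omega> s v \<noteq> None" using s t out by auto
    fix r assume r: "outp_at A G b' \<omega> r v \<noteq> None"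
    show "s \<le> r"
    proof (rule ccontr)
      assume "\<not> s \<le> r"
      then have "outp_at A G b \<omega> r v \<noteq> None" using r out[of r] s t by auto
      then have "s \<le> r" unfolding s_def by (rule Least_le)
      with \<open>\<not> s \<le> r\<close> show False by simp
    qed
  qed
  then show ?thesis using v s t out[of s] by (simp add: result_def s_def)
qed

lemma finite_short_messages: "finite {xs :: message. length xs \<le> K}"
  using finite_lists_length_le[of "UNIV :: bool set" K] by simp

lemma card_short_messages: "card {xs :: message. length xs \<le> K} \<le> 2 ^ (K + 1)"
proof -
  have "card {xs :: message. length xs \<le> K} = (\<Sum>i\<le>K. 2 ^ i)"
    using card_lists_length_le[of "UNIV :: bool set" K] by simp
  also have "\<dots> < 2 ^ (K + 1)"
    using sum_power2[of "Suc K"]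
      by (simp add: atLeast0AtMost[symmetric] atLeastLessThanSuc_atLeastAtMost)
  finally show ?thesis by simp
qed

text \<open>Lengths are integers, so a length below \<open>K + 1\<close> is at most
  \<open>K\<close>. Each crossing thus carries one of at most \<open>2 ^ (K + 1)\<close> bit
  strings.\<close>

lemma card_transcripts:
  assumes A: "congest \<beta> A" and K: "\<beta> * log 2 (real (nverts G)) < real K + 1"
    and X: "finite (crossing G R T)" "card (crossing G R T) \<le> c"
  shows "finite (transcript A G R \<omega> T ` \<B>) \<and> card (transcript A G R \<omega> T ` \<B>) \<le> 2 ^ ((K + 1) * c)"
proof -
  let ?P = "crossing G R T \<rightarrow>\<^sub>E {xs :: message. length xs \<le> K}"
  have len: "length (send A (local_of G b u) (\<omega> u) (hist A G b \<omega> t u) i) \<le> K" for b u t i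
  proof -
    have "real (length (send A (local_of G b u) (\<omega> u) (hist A G b \<omega> t u) i))
        \<le> \<beta> * log 2 (real (net_size (local_of G b u)))"
      using A unfolding congest_def by blast
    also have "\<dots> < real K + 1" using K by (simp add: local_of_def)
    finally show ?thesis by linarith
  qed
  have sub: "transcript A G R \<omega> T ` \<B> \<subseteq> ?P"
    by (auto simp: transcript_def PiE_iff len)
  have fin: "finite ?P" using X(1) finite_short_messages by (intro finite_PiE) auto
  have "card ?P = card {xs :: message. length xs \<le> K} ^ card (crossing G R T)"
    using X(1) by (simp add: card_PiE)
  also have "\<dots> \<le> (2 ^ (K + 1)) ^ card (crossing G R T)"
    by (rule power_mono[OF card_short_messages]) simp
  also have "\<dots> \<le> (2 ^ (K + 1)) ^ c" using X(2) by (intro power_increasing) auto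
  also have "\<dots> = 2 ^ ((K + 1) * c)" by (rule power_mult[symmetric])
  finally show ?thesis using sub fin by (meson card_mono finite_subset le_trans)
qed

section \<open>Averaging over the coins, and counting\<close>

lemma prob_space_coin_measure: "prob_space coin_measure"
  unfolding coin_measure_def by (intro prob_space_PiM measure_pmf.prob_space_axioms)

text \<open>The expected number of events that occur is at least \<open>p * card I\<close>. The
  number takes finitely many values, so its maximum is attained and is at least the
  expectation.\<close>

lemma (in prob_space) exists_point_in_many_events:
  assumes I: "finite I" and S: "\<And>i. i \<in> I \<Longrightarrow> S i \<in> events" "\<And>i. i \<in> I \<Longrightarrow> p \<le> prob (S i)"
  shows "\<exists>\<omega>. p * card I \<le> card {i \<in> I. \<omega> \<in> S i}"
proof -
  let ?f = "\<lambda>\<omega>. card {i \<in> I. \<omega> \<in> S i}"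
  have le: "?f \<omega> \<le> card I" for \<omega> using I by (auto intro: card_mono)
  then have "finite (range ?f)" by (auto intro!: finite_subset[of _ "{..card I}"])
  then obtain \<omega> where \<omega>: "Max (range ?f) = ?f \<omega>"
    using Max_in[of "range ?f"] by fastforce
  have max: "?f \<omega>' \<le> ?f \<omega>" for \<omega>' using Max_ge[OF \<open>finite (range ?f)\<close>, of "?f \<omega>'"] \<omega> by auto
  have f: "real (?f \<omega>') = (\<Sum>i\<in>I. indicator (S i) \<omega>')" for \<omega>'
    using I by (simp add: indicator_def sum.If_cases Int_def)
  have "p * card I \<le> (\<Sum>i\<in>I. prob (S i))" using sum_bounded_below[of I p "\<lambda>i. prob (S i)"] S
      by (simp add: mult.commute)
  also have "\<dots> = (\<Sum>i\<in>I. expectation (indicator (S i)))" using S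
      by (simp add: Bochner_Integration.integral_indicator)
  also have "\<dots> = expectation (\<lambda>\<omega>'. \<Sum>i\<in>I. indicator (S i) \<omega>')"
    using S by (subst Bochner_Integration.integral_sum) (auto intro: integrable_real_indicator
      simp: emeasure_eq_measure)
  also have "\<dots> \<le> expectation (\<lambda>_. real (?f \<omega>))"
  proof (rule integral_mono)
    show "integrable M (\<lambda>\<omega>'. \<Sum>i\<in>I. indicator (S i) \<omega>' :: real)"
      using S by (auto intro!: Bochner_Integration.integrable_sum integrable_real_indicator
        simp: emeasure_eq_measure)
    show "(\<Sum>i\<in>I. indicator (S i) \<omega>') \<le> real (?f \<omega>)" for \<omega>'
      using max[of \<omega>'] by (simp flip: f)
  qed simp
  finally show ?thesis by (auto simp: prob_space)
qed

lemma card_le_fibres: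
  assumes fin: "finite A" and C: "card (f ` A) \<le> N"
    and fib: "\<And>x. x \<in> A \<Longrightarrow> real (card {y \<in> A. f y = f x}) \<le> V" and V: "V \<ge> 0"
  shows "real (card A) \<le> real N * V"
proof -
  have "real (card A) = (\<Sum>z\<in>f ` A. real (card {y \<in> A. f y = z}))"
    using sum.image_gen[OF fin, of "\<lambda>_. 1::nat" f] by simp
  also have "\<dots> \<le> (\<Sum>z\<in>f ` A. V)" using fib by (intro sum_mono) auto
  also have "\<dots> = real (card (f ` A)) * V" by simp
  also have "\<dots> \<le> real N * V" using C V by (intro mult_right_mono) auto
  finally show ?thesis .
qed

text \<open>The Chernoff-type bound \<open>1 \<le> 2 powr (m/3 - |U|)\<close> on the ball, summed over all of \<open>Pow\<close>.\<close>

lemma card_hamming_ball: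
  assumes S: "S \<subseteq> {..<m}" and F: "F \<subseteq> Pow {..<m}"
    and d: "\<And>S'. S' \<in> F \<Longrightarrow> real (card (sym_diff S S')) \<le> real m / 3"
  shows "real (card F) \<le> (3/2) ^ m * 2 powr (real m / 3)"
proof -
  have finF: "finite F" using F by (auto intro: finite_subset)
  have inj: "inj_on (sym_diff S) F" by (auto simp: inj_on_def)
  have "real (card F) = (\<Sum>U\<in>sym_diff S ` F. 1)" using card_image[OF inj] by simp
  also have "\<dots> \<le> (\<Sum>U\<in>sym_diff S ` F. (1/2) ^ card U * 2 powr (real m / 3))"
  proof (rule sum_mono)
    fix U assume "U \<in> sym_diff S ` F"
    then have "real (card U) \<le> real m / 3" using d by auto
    then have "1 \<le> 2 powr (real m / 3 - real (card U))" by (simp add: ge_one_powr_ge_zero)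
    also have "\<dots> = (1/2) ^ card U * 2 powr (real m / 3)"
      by (simp add: powr_diff powr_realpow power_divide)
    finally show "1 \<le> (1/2) ^ card U * 2 powr (real m / 3)" .
  qed
  also have "\<dots> \<le> (\<Sum>U\<in>Pow {..<m}. (1/2) ^ card U * 2 powr (real m / 3))"
    using S F by (intro sum_mono2) auto
  also have "\<dots> = (\<Sum>U\<in>Pow {..<m}. (1/2) ^ card U) * 2 powr (real m / 3)"
    by (simp add: sum_distrib_right)
  also have "(\<Sum>U\<in>Pow {..<m}. (1/2 :: real) ^ card U) = (3/2) ^ m"
    using prod_add[of "{..<m}" "\<lambda>_. 1/2 :: real" "\<lambda>_. 1"] by simp
  finally show ?thesis .
qed

section \<open>The diameter bound\<close>

lemma hop_dist_le: "(u, v) \<in> edge_rel G ^^ k \<Longrightarrow> hop_dist G u v \<le> k"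
  unfolding hop_dist_def by (rule Least_le)

lemma relpow_lipschitz:
  fixes \<phi> :: "'a \<Rightarrow> int"
  assumes "\<And>u v. (u, v) \<in> E \<Longrightarrow> \<bar>\<phi> u - \<phi> v\<bar> \<le> 1" and "(u, v) \<in> E ^^ k"
  shows "\<bar>\<phi> u - \<phi> v\<bar> \<le> int k"
  using assms(2)
proof (induction k arbitrary: v)
  case (Suc k)
  then obtain w where w: "(u, w) \<in> E ^^ k" "(w, v) \<in> E" by auto
  with Suc.IH[OF w(1)] assms(1)[OF w(2)] show ?case by simp
qed simp

text \<open>A function that changes by at most 1 along edges and differs by \<open>D\<close> between
  \<open>a\<close> and \<open>b\<close> bounds their distance from below. Reachability is used
  first, so that the \<open>LEAST\<close> in \<open>hop_dist\<close> is attained.\<close>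

lemma diam_eqI:
  fixes \<phi> :: "nat \<Rightarrow> int"
  assumes reach: "\<And>u v. u < nverts G \<Longrightarrow> v < nverts G \<Longrightarrow> \<exists>k\<le>D. (u, v) \<in> edge_rel G ^^ k"
    and lip: "\<And>u v. adjacent G u v \<Longrightarrow> \<bar>\<phi> u - \<phi> v\<bar> \<le> 1"
    and far: "a < nverts G" "b < nverts G" "\<phi> b - \<phi> a = int D"
  shows "diam G = D"
proof -
  let ?H = "{hop_dist G u v | u v. u < nverts G \<and> v < nverts G}"
  have fin: "finite ?H"
    using finite_image_set2[of "\<lambda>u. u < nverts G" "\<lambda>v. v < nverts G" "hop_dist G"] by simp
  have le: "hop_dist G u v \<le> D" if "u < nverts G" "v < nverts G" for u v
    using reach[OF that] hop_dist_le by (meson order_trans)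
  obtain k where "(a, b) \<in> edge_rel G ^^ k" using reach far by blast
  then have "(a, b) \<in> edge_rel G ^^ hop_dist G a b" unfolding hop_dist_def by (rule LeastI)
  then have "\<bar>\<phi> a - \<phi> b\<bar> \<le> int (hop_dist G a b)"
    by (rule relpow_lipschitz[rotated]) (use lip in \<open>auto simp: edge_rel_def\<close>)
  then have eq: "hop_dist G a b = D" using le[of a b] far by auto
  show ?thesis unfolding diam_def
  proof (rule Max_eqI[OF fin])
    show "D \<in> ?H" using eq far by blast
  qed (use le in auto)
qed

lemma relpow_sym: "sym E \<Longrightarrow> (u, v) \<in> E ^^ k \<Longrightarrow> (v, u) \<in> E ^^ k"
proof (induction k arbitrary: v)
  case (Suc k)
  then obtain w where "(u, w) \<in> E ^^ k" "(w, v) \<in> E" by auto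
  with Suc show ?case by (meson relpow_Suc_I2 symD)
qed simp

section \<open>Large diameter: the path network\<close>

lemma sum_pairs_le:
  fixes f :: "nat \<Rightarrow> nat \<Rightarrow> real"
  assumes "P \<subseteq> {..<n} \<times> {..<n}" and "\<And>u v. f u v \<ge> 0"
  shows "(\<Sum>(u, v)\<in>P. f u v) \<le> (\<Sum>u<n. \<Sum>v<n. f u v)"
  unfolding sum.cartesian_product using assms by (intro sum_mono2) auto

text \<open>Every edge is listed in one orientation only; the network adds both. The pendants hang
  on vertex 1, so that their distance from the far end is again \<open>D\<close>.\<close>

definition path_edge :: "nat \<Rightarrow> nat \<Rightarrow> nat \<Rightarrow> nat" where
  "path_edge D u v =
     (if v = Suc u \<and> v \<le> D then (if u = D div 2 then 1 else D) else if u = 1 \<and> v > D then 1 else 0)"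

text \<open>
  A path \<open>0, \<dots>, D\<close> whose middle edge is light, so that it carries half of the energy of a flow
  between the two ends; the vertices beyond \<open>D\<close> are pendants that bring the order up to \<open>n\<close>.
\<close>

definition path_network :: "nat \<Rightarrow> nat \<Rightarrow> network" where
  "path_network n D = \<lparr>nverts = n, ident = id, wt = (\<lambda>u v. path_edge D u v + path_edge D v u)\<rparr>"

definition path_rhs :: "nat \<Rightarrow> int \<Rightarrow> nat \<Rightarrow> int" where
  "path_rhs D s v = (if v = 0 then s * int D else if v = D then - s * int D else 0)"

text \<open>The exact solution for a current \<open>s * D\<close> from vertex 0 to vertex
  \<open>D\<close>: a drop of \<open>s\<close> across an edge of weight \<open>D\<close>, a drop of
  \<open>s * D\<close> across the light edge. The pendants share the potential of vertex 1.\<close>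

definition path_potential :: "nat \<Rightarrow> int \<Rightarrow> nat \<Rightarrow> real" where
  "path_potential D s v =
     s * (if v > D then 2 * real D - 2 else if v \<le> D div 2 then 2 * real D - 1 - v else real D - v)"

lemma path_network_simps [simp]:
  "nverts (path_network n D) = n" "ident (path_network n D) = id"
  "wt (path_network n D) u v = path_edge D u v + path_edge D v u"
  by (simp_all add: path_network_def)

lemma path_network_reach:
  assumes D: "2 \<le> D" "D < n" and uv: "u < n" "v < n"
  shows "\<exists>k\<le>D. (u, v) \<in> edge_rel (path_network n D) ^^ k"
proof -
  let ?E = "edge_rel (path_network n D)"
  have sym: "sym ?E" by (auto simp: sym_def edge_rel_def adjacent_def)
  have step: "(j, Suc j) \<in> ?E" if "j < D" for j
    using that D by (auto simp: edge_rel_def adjacent_def path_edge_def)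
  have pend: "(1, v) \<in> ?E" if "v > D" "v < n" for v
    using that D by (auto simp: edge_rel_def adjacent_def path_edge_def)
  have path: "(i, i + k) \<in> ?E ^^ k" if "i + k \<le> D" for i k
    using that
  proof (induction k)
    case (Suc k)
    then have "(i, i + k) \<in> ?E ^^ k" "(i + k, Suc (i + k)) \<in> ?E" using step by auto
    then show ?case by auto
  qed simp
  have main: "\<exists>k\<le>D. (u, v) \<in> ?E ^^ k" if "u \<le> v" "v < n" for u v
  proof -
    consider "v \<le> D" | "u = 0" "v > D" | "u \<ge> 1" "u \<le> D" "v > D" | "u > D" "v > D" by linarith
    then show ?thesis
    proof cases
      case 1
      then show ?thesis using path[of u "v - u"] that by (intro exI[of _ "v - u"]) auto
    next
      case 2
      then have "(u, v) \<in> ?E ^^ 2" using step[of 0] pend[of v] that D by (auto simp: numeral_2_eq_2)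
      then show ?thesis using D by blast
    next
      case 3
      then have "(u, 1) \<in> ?E ^^ (u - 1)" using path[of 1 "u - 1"] relpow_sym[OF sym] by simp
      then have "(u, v) \<in> ?E ^^ Suc (u - 1)" using pend[of v] that 3 by (intro relpow_Suc_I) auto
      then show ?thesis using 3 by (intro exI[of _ "Suc (u - 1)"]) auto
    next
      case 4
      then have "(u, v) \<in> ?E ^^ 2" using pend[of u] pend[of v] that symD[OF sym]
        by (auto simp: numeral_2_eq_2)
      then show ?thesis using D by blast
    qed
  qed
  show ?thesis
  proof (cases "u \<le> v")
    case False
    then obtain k where "k \<le> D" "(v, u) \<in> ?E ^^ k" using main[of v u] uv by auto
    then show ?thesis using relpow_sym[OF sym] by blast
  qed (use main uv in auto)
qed

lemma diam_path_network:
  assumes D: "2 \<le> D" "D < n"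
  shows "diam (path_network n D) = D"
\<comment> \<open>Value 0 on the pendants is one step away from the value at vertex 1, their only
  neighbour.\<close>
proof (rule diam_eqI[where \<phi> = "\<lambda>v. if v \<le> D then int v else 0" and a = 0 and b = D])
  show "\<exists>k\<le>D. (u, v) \<in> edge_rel (path_network n D) ^^ k"
    if "u < nverts (path_network n D)" "v < nverts (path_network n D)" for u v
    using path_network_reach[OF D] that by simp
qed (use D in \<open>auto simp: adjacent_def path_edge_def split: if_splits\<close>)

lemma valid_path_network:
  assumes D: "2 \<le> D" "D < n" and \<kappa>: "\<kappa> \<ge> 1"
  shows "valid_network \<kappa> (path_network n D)"
proof -
  have n: "n \<le> n ^ \<kappa>" using D \<kappa> by (intro self_le_power) auto
  have "path_edge D u v + path_edge D v u \<le> D" for u v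
    using D by (auto simp: path_edge_def)
  then have w: "path_edge D u v + path_edge D v u \<le> n ^ \<kappa>" for u v
    using n D by (meson less_imp_le_nat order_trans)
  have "(u, v) \<in> (edge_rel (path_network n D))\<^sup>*" if "u < n" "v < n" for u v
    using path_network_reach[OF D that] by (auto simp: rtrancl_power)
  then show ?thesis using w n D
    by (auto simp: valid_network_def path_edge_def intro: order.strict_trans2)
qed

lemma path_potential_flow:
  assumes "2 \<le> D"
  shows "real (path_edge D v u) * (path_potential D s v - path_potential D s u)
    = (if u = Suc v \<and> v < D then s * real D else 0)"
  using assms by (auto simp: path_edge_def path_potential_def algebra_simps)

text \<open>Current leaving minus current entering: the two cancel except at the ends of the
  path.\<close>

lemma path_potential_laplacian:
  assumes D: "2 \<le> D" "D < n" and v: "v < n"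
  shows "(\<Sum>u<n. real (path_edge D v u + path_edge D u v) * (path_potential D s v
      - path_potential D s u))
    = path_rhs D s v"
proof -
  have "(\<Sum>u<n. real (path_edge D v u + path_edge D u v) * (path_potential D s v
      - path_potential D s u))
    = (\<Sum>u<n. real (path_edge D v u) * (path_potential D s v - path_potential D s u)
       - real (path_edge D u v) * (path_potential D s u - path_potential D s v))"
    by (intro sum.cong) (auto simp: algebra_simps)
  also have "\<dots> = (\<Sum>u<n. if u = Suc v \<and> v < D then s * real D else 0)
      - (\<Sum>u<n. if v = Suc u \<and> u < D then s * real D else 0)"
    by (simp add: sum_subtractf path_potential_flow[OF D(1)])
  also have "(\<Sum>u<n. if u = Suc v \<and> v < D then s * real D else 0)
      = (if v < D then s * real D else 0)"
    using D by (auto simp: sum.delta)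
  also have "(\<Sum>u<n. if v = Suc u \<and> u < D then s * real D else 0)
      = (\<Sum>u<n. if u = v - 1 then (if 0 < v \<and> v \<le> D then s * real D else 0) else 0)"
    by (intro sum.cong) auto
  also have "\<dots> = (if 0 < v \<and> v \<le> D then s * real D else 0)"
    using v by (auto simp: sum.delta)
  finally show ?thesis using D by (auto simp: path_rhs_def)
qed

lemma path_rounds:
  assumes sol: "solves_laplacian_within \<kappa> \<epsilon> A T" and eps: "\<epsilon> \<le> 1/2" and \<kappa>: "\<kappa> \<ge> 1"
    and D: "2 \<le> D" "D < n"
  shows "D div 2 \<le> T n D + 1"
proof (rule ccontr)
  assume "\<not> D div 2 \<le> T n D + 1"
  then have T: "T n D + 2 \<le> D div 2" by simp
  let ?G = "path_network n D" and ?c = "D div 2" and ?T = "T n D"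
  have V: "valid_network \<kappa> ?G" using valid_path_network[OF D \<kappa>] .
  have "int n \<le> int n ^ \<kappa>" using D \<kappa> by (intro self_le_power) auto
  then have rhs: "valid_rhs \<kappa> ?G (path_rhs D s)" if "s \<in> {1, -1}" for s
    using D that by (auto simp: valid_rhs_def path_rhs_def)
  have "\<forall>s\<in>{1,-1::int}. \<exists>S\<in>sets coin_measure. measure coin_measure S \<ge> 2/3 \<and>
       (\<forall>\<omega>\<in>S. finishes_within A ?G (path_rhs D s) \<omega> ?T \<and>
          laplacian_solution \<epsilon> ?G (path_rhs D s) (result A ?G (path_rhs D s) \<omega>))"
    using sol V rhs diam_path_network[OF D]
    unfolding solves_laplacian_within_def by (metis path_network_simps(1))
  then obtain S where S: "\<And>s. s \<in> {1,-1} \<Longrightarrow> S s \<in> sets coin_measure"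
    "\<And>s. s \<in> {1,-1} \<Longrightarrow> 2/3 \<le> measure coin_measure (S s)"
    and ok: "\<And>s \<omega>. s \<in> {1,-1} \<Longrightarrow> \<omega> \<in> S s \<Longrightarrow> finishes_within A ?G (path_rhs D s) \<omega> ?T"
      "\<And>s \<omega>. s \<in> {1,-1} \<Longrightarrow> \<omega> \<in> S s \<Longrightarrow>
        laplacian_solution \<epsilon> ?G (path_rhs D s) (result A ?G (path_rhs D s) \<omega>)"
    by metis
  interpret prob_space coin_measure by (rule prob_space_coin_measure)
  obtain \<omega> where "2/3 * card {1, -1 :: int} \<le> card {s \<in> {1,-1}. \<omega> \<in> S s}"
    using exists_point_in_many_events[of "{1,-1}" S "2/3"] S by auto
  \<comment> \<open>The average 4/3 rounds up to 2: one choice of coins succeeds for both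
    signs.\<close>
  then have "card {1, -1 :: int} \<le> card {s \<in> {1,-1}. \<omega> \<in> S s}" by simp
  then have "{s \<in> {1,-1}. \<omega> \<in> S s} = {1,-1}" by (intro card_seteq) auto
  then have \<omega>: "\<omega> \<in> S s" if "s \<in> {1,-1}" for s using that by blast
  \<comment> \<open>The region loses one vertex at each end per round, as fast as news travels, so
    nothing crosses into it. Pendants affect only vertex 1, which leaves after round 0.\<close>
  define R where "R t = {v. t + 1 \<le> v \<and> v + t + 1 \<le> D}" for t
  have "crossing ?G R ?T = {}"
    by (auto simp: crossing_def R_def adjacent_def path_edge_def split: if_splits)
  then have tr: "transcript A ?G R \<omega> ?T b = transcript A ?G R \<omega> ?T b'" for b b'
    unfolding transcript_def by (simp add: restrict_def)
  have eq: "result A ?G (path_rhs D 1) \<omega> $ v = result A ?G (path_rhs D (-1)) \<omega> $ v"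
    if "v \<in> R ?T" for v
    by (rule result_eq_if_transcript_eq[of ?T R])
      (use that tr ok \<omega> D in \<open>auto simp: R_def path_rhs_def\<close>)
  have R: "?c \<in> R ?T" "Suc ?c \<in> R ?T" using T by (auto simp: R_def)
  define d where "d s = result A ?G (path_rhs D s) \<omega> $ ?c
      - result A ?G (path_rhs D s) \<omega> $ Suc ?c" for s
  have d: "d 1 = d (-1)" using eq R by (simp add: d_def)
  \<comment> \<open>Of the error energy only the middle edge is kept, in both orders; the solution
    itself has energy \<open>D * (2 * D - 1)\<close>.\<close>
  have bound: "(d s - s * real D)\<^sup>2 \<le> real D * (2 * real D - 1) / 4" if s: "s \<in> {1,-1}" for s :: int
  proof -
    define x where "x = result A ?G (path_rhs D s) \<omega>"
    define e where "e v = x $ v - path_potential D s v" for v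
    have "(\<Sum>u<nverts ?G. \<Sum>v<nverts ?G. real (wt ?G u v) * (e u - e v)\<^sup>2)
        \<le> (\<Sum>v<nverts ?G. path_potential D s v * path_rhs D s v) / 2"
      unfolding e_def
      by (rule laplacian_solution_energy[OF V _ _ _ eps])
        (use ok(2)[OF s \<omega>[OF s]] path_potential_laplacian[OF D] in \<open>auto simp: x_def result_def\<close>)
    also have "(\<Sum>v<nverts ?G. path_potential D s v * path_rhs D s v)
        = (\<Sum>v\<in>{0, D}. path_potential D s v * path_rhs D s v)"
      using D by (intro sum.mono_neutral_right) (auto simp: path_rhs_def)
    also have "\<dots> = real D * (2 * real D - 1)"
      using D s by (auto simp: path_rhs_def path_potential_def)
    finally have "(\<Sum>u<n. \<Sum>v<n. real (wt ?G u v) * (e u - e v)\<^sup>2) \<le> real D * (2 * real D - 1) / 2"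
        by simp
    moreover have "(\<Sum>(u, v)\<in>{(?c, Suc ?c), (Suc ?c, ?c)}. real (wt ?G u v) * (e u - e v)\<^sup>2)
        \<le> (\<Sum>u<n. \<Sum>v<n. real (wt ?G u v) * (e u - e v)\<^sup>2)"
      using D by (intro sum_pairs_le) auto
    moreover have "(\<Sum>(u, v)\<in>{(?c, Suc ?c), (Suc ?c, ?c)}. real (wt ?G u v) * (e u - e v)\<^sup>2)
        = 2 * (e ?c - e (Suc ?c))\<^sup>2"
      using D by (auto simp: path_edge_def power2_commute)
    moreover have "e ?c - e (Suc ?c) = d s - s * real D"
      using D by (simp add: e_def d_def x_def path_potential_def algebra_simps)
    ultimately show ?thesis by simp
  qed
  \<comment> \<open>The same reading \<open>d 1\<close> would have to be close to both
    \<open>D\<close> and \<open>-D\<close>.\<close>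
  have "(d 1 - real D)\<^sup>2 + (d 1 + real D)\<^sup>2 \<le> real D * (2 * real D - 1) / 2"
    using bound[of 1] bound[of "-1"] d by simp
  moreover have "(d 1 - real D)\<^sup>2 + (d 1 + real D)\<^sup>2 = 2 * (d 1)\<^sup>2 + 2 * (real D)\<^sup>2"
    by (simp add: power2_eq_square algebra_simps)
  moreover have "real D * (2 * real D - 1) / 2 < 2 * (real D)\<^sup>2"
    using D by (simp add: power2_eq_square algebra_simps add_pos_pos)
  ultimately show False using zero_le_power2[of "d 1"] by linarith
qed

section \<open>The highway network and its flow\<close>

text \<open>The Boolean tells the two rows of a pair apart. \<open>Tree e k\<close> has height
  \<open>e\<close> and lies above the columns \<open>j\<close> with
  \<open>j div 2 ^ e = k\<close>.\<close>

datatype vertex = Row bool nat nat | Tree nat nat | Tail nat | Pendant nat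

text \<open>The heavy last rung gives the last column energy \<open>1000 * 8 ^ h\<close> per row,
  while the total per row is at most \<open>1221 * 8 ^ h\<close>: more than four fifths, enough to
  beat the accuracy 1/2.\<close>

definition rung :: "nat \<Rightarrow> nat \<Rightarrow> nat" where
  "rung h j = (if Suc j = 2 ^ h then 10 * 2 ^ h else 1)"

definition pot :: "nat \<Rightarrow> nat \<Rightarrow> nat" where
  "pot h j = 10 * 2 ^ h + (2 ^ h - 1 - j)"

text \<open>
  The potential falls by 1 along every row edge, so by flow conservation the weight of the row edge
  into column \<open>j\<close> has to be the total current that leaves the row in the columns \<open>\<ge> j\<close>.
\<close>

definition flow :: "nat \<Rightarrow> nat \<Rightarrow> nat" where
  "flow h j = (\<Sum>k\<in>{j..<2 ^ h}. rung h k * pot h k)"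

fun highway_edge :: "nat \<Rightarrow> vertex \<Rightarrow> vertex \<Rightarrow> nat" where
  "highway_edge h (Row \<sigma> i j) (Row \<sigma>' i' j') =
     (if \<sigma>' = \<sigma> \<and> i' = i \<and> j' = Suc j then flow h (Suc j) else 0)"
| "highway_edge h (Row \<sigma> i j) (Tree e k) = (if e = 0 \<and> k = j then rung h j else 0)"
| "highway_edge h (Tree e k) (Tree e' k') = (if e' = Suc e \<and> k' = k div 2 then 1 else 0)"
| "highway_edge h (Tree e k) (Tail q) = (if e = h \<and> q = 0 then 1 else 0)"
| "highway_edge h (Tree e k) (Pendant q) = (if e = h then 1 else 0)"
| "highway_edge h (Tail q) (Tail q') = (if q' = Suc q then 1 else 0)"
| "highway_edge h _ _ = 0"

definition core_vertices :: "nat \<Rightarrow> nat \<Rightarrow> nat \<Rightarrow> vertex set" where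
  "core_vertices h m Q = (\<lambda>(\<sigma>, i, j). Row \<sigma> i j) ` (UNIV \<times> {..<m} \<times> {..<2 ^ h})
     \<union> (\<lambda>(e, k). Tree e k) ` (SIGMA e:{..h}. {..<2 ^ (h - e)}) \<union> Tail ` {..<Q}"

definition highway_vertices :: "nat \<Rightarrow> nat \<Rightarrow> nat \<Rightarrow> nat \<Rightarrow> vertex set" where
  "highway_vertices h m Q p = core_vertices h m Q \<union> Pendant ` {..<p}"

lemma highway_vertices_iff [simp]:
  "Row \<sigma> i j \<in> highway_vertices h m Q p \<longleftrightarrow> i < m \<and> j < 2 ^ h"
  "Tree e k \<in> highway_vertices h m Q p \<longleftrightarrow> e \<le> h \<and> k < 2 ^ (h - e)"
  "Tail q \<in> highway_vertices h m Q p \<longleftrightarrow> q < Q"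
  "Pendant r \<in> highway_vertices h m Q p \<longleftrightarrow> r < p"
  by (auto simp: highway_vertices_def core_vertices_def image_iff)

lemma finite_core_vertices: "finite (core_vertices h m Q)"
  by (auto simp: core_vertices_def)

lemma finite_highway_vertices [simp]: "finite (highway_vertices h m Q p)"
  by (auto simp: highway_vertices_def finite_core_vertices)

lemma card_core_vertices: "card (core_vertices h m Q) \<le> 2 * m * 2 ^ h + 2 ^ h * 2 ^ h + Q"
proof -
  have "card ((\<lambda>(\<sigma>, i, j). Row \<sigma> i j) ` (UNIV \<times> {..<m} \<times> {..<2 ^ h}))
      \<le> card ((UNIV :: bool set) \<times> {..<m} \<times> {..<2 ^ h :: nat})"
    by (rule card_image_le) auto
  then have 1: "card ((\<lambda>(\<sigma>, i, j). Row \<sigma> i j) ` (UNIV \<times> {..<m} \<times> {..<2 ^ h})) \<le> 2 * m * 2 ^ h"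
    by (simp add: card_cartesian_product)
  have "card ((\<lambda>(e, k). Tree e k) ` (SIGMA e:{..h}. {..<2 ^ (h - e)}))
      \<le> card (SIGMA e:{..h}. {..<2 ^ (h - e) :: nat})"
    by (rule card_image_le) auto
  also have "\<dots> = (\<Sum>e\<le>h. 2 ^ (h - e))" by simp
  also have "\<dots> \<le> (\<Sum>e\<le>h. 2 ^ h)" by (intro sum_mono power_increasing) auto
  also have "\<dots> = Suc h * 2 ^ h" by simp
  also have "\<dots> \<le> 2 ^ h * 2 ^ h" using less_exp[of h]
      by (intro mult_right_mono) (auto simp: Suc_le_eq)
  finally have 2: "card ((\<lambda>(e, k). Tree e k) ` (SIGMA e:{..h}. {..<2 ^ (h - e)})) \<le> 2 ^ h * 2 ^ h" .
  have 3: "card (Tail ` {..<Q}) \<le> Q" using card_image_le[of "{..<Q}" Tail] by simp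
  show ?thesis unfolding core_vertices_def
    using 1 2 3 by (intro order_trans[OF card_Un_le] add_mono) auto
qed

lemma exists_highway_vertices:
  assumes "2 * m * 2 ^ h + 2 ^ h * 2 ^ h + Q \<le> n"
  shows "\<exists>p. card (highway_vertices h m Q p) = n"
proof -
  have "card (highway_vertices h m Q p) = card (core_vertices h m Q) + p" for p
  proof -
    have "card (Pendant ` {..<p}) = p" by (simp add: card_image inj_on_def)
    moreover have "core_vertices h m Q \<inter> Pendant ` {..<p} = {}" by (auto simp: core_vertices_def)
    ultimately show ?thesis
      unfolding highway_vertices_def by (simp add: card_Un_disjoint finite_core_vertices)
  qed
  then show ?thesis using card_core_vertices[of h m Q] assms
    by (intro exI[of _ "n - card (core_vertices h m Q)"]) simp
qed

lemma flow_le: "flow h j \<le> 111 * 2 ^ h * 2 ^ h"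
proof -
  \<comment> \<open>A light rung carries at most \<open>11 * 2 ^ h\<close>; the last one carries
    \<open>100 * 4 ^ h\<close>, accounted for by the extra term.\<close>
  have "flow h j \<le> (\<Sum>k\<in>{j..<2 ^ h}. 11 * 2 ^ h + (if k = 2 ^ h
      - 1 then 100 * 2 ^ h * 2 ^ h else 0))"
    unfolding flow_def by (intro sum_mono) (auto simp: rung_def pot_def)
  also have "\<dots> \<le> (\<Sum>k\<in>{..<2 ^ h :: nat}. 11 * 2 ^ h + (if k = 2 ^ h
      - 1 then 100 * 2 ^ h * 2 ^ h else 0))"
    by (intro sum_mono2) auto
  also have "\<dots> = 111 * 2 ^ h * 2 ^ h" by (simp add: sum.distrib)
  finally show ?thesis .
qed

lemma flow_rec: "j < 2 ^ h \<Longrightarrow> flow h j = rung h j * pot h j + flow h (Suc j)"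
  by (simp add: flow_def sum.atLeast_Suc_lessThan)

lemma flow_end: "flow h (2 ^ h) = 0"
  by (simp add: flow_def)

text \<open>\<open>S\<close> encodes the sign pattern; the two rows of a pair receive opposite
  signs.\<close>

definition sgn_of :: "nat set \<Rightarrow> bool \<Rightarrow> nat \<Rightarrow> int" where
  "sgn_of S \<sigma> i = (if (i \<in> S) = \<sigma> then 1 else -1)"

fun highway_pot :: "nat \<Rightarrow> nat set \<Rightarrow> vertex \<Rightarrow> real" where
  "highway_pot h S (Row \<sigma> i j) = sgn_of S \<sigma> i * real (pot h j)"
| "highway_pot h S _ = 0"

fun highway_rhs :: "nat \<Rightarrow> nat set \<Rightarrow> vertex \<Rightarrow> int" where
  "highway_rhs h S (Row \<sigma> i j) = (if j = 0 then sgn_of S \<sigma> i * int (flow h 0) else 0)"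
| "highway_rhs h S _ = 0"

lemma highway_pot_nonzero: "highway_pot h S a \<noteq> 0 \<Longrightarrow> \<exists>\<sigma> i j. a = Row \<sigma> i j"
  by (cases a) auto

lemma sgn_of_sum: "sgn_of S True i + sgn_of S False i = 0"
  by (simp add: sgn_of_def)

lemma highway_current:
  assumes "a \<in> highway_vertices h m Q p" "c \<in> highway_vertices h m Q p"
  shows "real (highway_edge h a c) * (highway_pot h S a - highway_pot h S c) =
    (case (a, c) of
       (Row \<sigma> i j, Row \<sigma>' i' j') \<Rightarrow> if \<sigma>' = \<sigma> \<and> i' = i \<and> j'
           = Suc j then sgn_of S \<sigma> i * real (flow h (Suc j)) else 0
     | (Row \<sigma> i j, Tree e k) \<Rightarrow> if e = 0 \<and> k = j then sgn_of S \<sigma> i * real (rung h j * pot h j) else 0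
     | _ \<Rightarrow> 0)"
proof -
  have "real (pot h j) - real (pot h (Suc j)) = 1" if "Suc j < 2 ^ h" for j
    using that by (simp add: pot_def of_nat_diff)
  then have "real (flow h (Suc j)) * (sgn_of S \<sigma> i * real (pot h j)
      - sgn_of S \<sigma> i * real (pot h (Suc j)))
      = sgn_of S \<sigma> i * real (flow h (Suc j))" if "Suc j < 2 ^ h" for \<sigma> i j
    using that by (simp flip: right_diff_distrib)
  then show ?thesis using assms by (cases a; cases c) auto
qed

text \<open>The current along the row and the current through the rung add up to
  \<open>flow h j\<close> by the recursion of \<open>flow\<close>. In the last column the row edge
  is missing and the remaining flow is 0.\<close>

lemma highway_current_out:
  assumes a: "a \<in> highway_vertices h m Q p"
  shows "(\<Sum>c\<in>highway_vertices h m Q p. real (highway_edge h a c) * (highway_pot h S a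
      - highway_pot h S c))
    = (case a of Row \<sigma> i j \<Rightarrow> sgn_of S \<sigma> i * real (flow h j) | _ \<Rightarrow> 0)"
proof (cases a)
  case (Row \<sigma> i j)
  have ij: "i < m" "j < 2 ^ h" using a Row by auto
  have "(\<Sum>c\<in>highway_vertices h m Q p. real (highway_edge h a c) * (highway_pot h S a
      - highway_pot h S c))
    = (\<Sum>c\<in>highway_vertices h m Q p. (if c
        = Row \<sigma> i (Suc j) then sgn_of S \<sigma> i * real (flow h (Suc j)) else 0)
        + (if c = Tree 0 j then sgn_of S \<sigma> i * real (rung h j * pot h j) else 0))"
    by (intro sum.cong refl, rule trans[OF highway_current[OF a]]) (auto
      simp: Row split: vertex.split)
  also have "\<dots> = (if Suc j < 2 ^ h then sgn_of S \<sigma> i * real (flow h (Suc j)) else 0)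
      + sgn_of S \<sigma> i * real (rung h j * pot h j)"
    using ij by (simp add: sum.distrib sum.delta)
  also have "\<dots> = sgn_of S \<sigma> i * real (flow h j)"
  proof (cases "Suc j < 2 ^ h")
    case False
    then have "Suc j = 2 ^ h" using ij by simp
    then show ?thesis using ij by (simp add: flow_rec flow_end)
  qed (use ij in \<open>simp add: flow_rec algebra_simps\<close>)
  finally show ?thesis by (simp add: Row)
qed (use a in \<open>auto intro!: sum.neutral dest!: highway_pot_nonzero\<close>)

lemma highway_current_in:
  assumes a: "a \<in> highway_vertices h m Q p"
  shows "(\<Sum>c\<in>highway_vertices h m Q p. real (highway_edge h c a) * (highway_pot h S c
      - highway_pot h S a))
    = (case a of Row \<sigma> i j \<Rightarrow> if j = 0 then 0 else sgn_of S \<sigma> i * real (flow h j) | _ \<Rightarrow> 0)"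
proof (cases a)
  case (Row \<sigma> i j)
  have ij: "i < m" "j < 2 ^ h" using a Row by auto
  \<comment> \<open>Subtraction is truncated: for \<open>j = 0\<close> the index
    \<open>j - 1\<close> is \<open>j\<close> itself, and the inner conditional makes that summand
    0.\<close>
  have "(\<Sum>c\<in>highway_vertices h m Q p. real (highway_edge h c a) * (highway_pot h S c
      - highway_pot h S a))
    = (\<Sum>c\<in>highway_vertices h m Q p.
        if c = Row \<sigma> i (j - 1) then (if j = 0 then 0 else sgn_of S \<sigma> i * real (flow h j)) else 0)"
    by (intro sum.cong refl, rule trans[OF highway_current[OF _ a]]) (auto
      simp: Row split: vertex.split)
  also have "\<dots> = (if j = 0 then 0 else sgn_of S \<sigma> i * real (flow h j))"
    using ij by (simp add: sum.delta)
  finally show ?thesis by (simp add: Row)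
next
  case (Tree e k)
  show ?thesis
  proof (cases "e = 0")
    case True
    let ?R = "(\<lambda>(\<sigma>, i). Row \<sigma> i k) ` (UNIV \<times> {..<m})"
    have k: "k < 2 ^ h" using a Tree True by simp
    have "(\<Sum>c\<in>highway_vertices h m Q p. real (highway_edge h c a) * (highway_pot h S c
        - highway_pot h S a))
      = (\<Sum>c\<in>?R. real (highway_edge h c a) * (highway_pot h S c - highway_pot h S a))"
    proof (intro sum.mono_neutral_right ballI)
      show "?R \<subseteq> highway_vertices h m Q p" using k by auto
      fix c assume c: "c \<in> highway_vertices h m Q p - ?R"
      then have "c \<noteq> Row \<sigma> i k" for \<sigma> i by (auto simp: image_iff)
      then show "real (highway_edge h c a) * (highway_pot h S c - highway_pot h S a) = 0"
        using c by (cases c) (auto simp: Tree)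
    qed simp
    also have "\<dots> = (\<Sum>(\<sigma>, i)\<in>UNIV \<times> {..<m}. sgn_of S \<sigma> i * real (rung h k * pot h k))"
      by (subst sum.reindex) (auto simp: inj_on_def Tree True intro!: sum.cong)
    \<comment> \<open>Antisymmetry at work: at a leaf the rung currents cancel within each pair of
      rows, so the tree can stay at potential 0.\<close>
    also have "\<dots> = (\<Sum>i<m. sgn_of S True i * real (rung h k * pot h k))
        + (\<Sum>i<m. sgn_of S False i * real (rung h k * pot h k))"
      by (simp add: sum.cartesian_product[symmetric] UNIV_bool)
    also have "\<dots> = (\<Sum>i<m. real_of_int (sgn_of S True i
        + sgn_of S False i) * real (rung h k * pot h k))"
      by (simp add: sum.distrib[symmetric] algebra_simps)
    finally show ?thesis by (simp add: sgn_of_sum Tree)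
  next
    case False
    then show ?thesis using a by (auto simp: Tree intro!: sum.neutral dest!: highway_pot_nonzero)
  qed
qed (use a in \<open>auto intro!: sum.neutral dest!: highway_pot_nonzero\<close>)

lemma highway_pot_laplacian:
  assumes a: "a \<in> highway_vertices h m Q p"
  shows "(\<Sum>c\<in>highway_vertices h m Q p. real (highway_edge h a c + highway_edge h c a) *
      (highway_pot h S a - highway_pot h S c)) = highway_rhs h S a"
proof -
  have "(\<Sum>c\<in>highway_vertices h m Q p. real (highway_edge h a c + highway_edge h c a) *
      (highway_pot h S a - highway_pot h S c)) =
    (\<Sum>c\<in>highway_vertices h m Q p. real (highway_edge h a c) * (highway_pot h S a
        - highway_pot h S c)
      - real (highway_edge h c a) * (highway_pot h S c - highway_pot h S a))"
    by (intro sum.cong) (auto simp: algebra_simps)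
  also have "\<dots> = highway_rhs h S a"
    by (simp add: sum_subtractf highway_current_out[OF a] highway_current_in[OF a] split: vertex.split)
  finally show ?thesis .
qed

section \<open>Energy of the highway flow\<close>

lemma sum_rows:
  fixes f :: "vertex \<Rightarrow> real"
  shows "(\<Sum>c\<in>(\<lambda>(\<sigma>, i). Row \<sigma> i j) ` (UNIV \<times> {..<m}). f c) = (\<Sum>i<m. f (Row True i j)
      + f (Row False i j))"
proof -
  have "(\<Sum>c\<in>(\<lambda>(\<sigma>, i). Row \<sigma> i j) ` (UNIV \<times> {..<m}). f c) = (\<Sum>(\<sigma>, i)\<in>UNIV \<times> {..<m}. f (Row \<sigma> i j))"
    by (subst sum.reindex) (auto simp: inj_on_def intro!: sum.cong)
  also have "\<dots> = (\<Sum>i<m. f (Row True i j)) + (\<Sum>i<m. f (Row False i j))"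
    by (simp add: sum.cartesian_product[symmetric] UNIV_bool add.commute)
  finally show ?thesis by (simp add: sum.distrib)
qed

lemma highway_total_energy:
  "(\<Sum>c\<in>highway_vertices h m Q p. highway_pot h S c * highway_rhs h S c)
      = 2 * real m * pot h 0 * flow h 0"
proof -
  let ?R = "(\<lambda>(\<sigma>, i). Row \<sigma> i 0) ` (UNIV \<times> {..<m})"
  have "(\<Sum>c\<in>highway_vertices h m Q p. highway_pot h S c * highway_rhs h S c)
    = (\<Sum>c\<in>?R. highway_pot h S c * highway_rhs h S c)"
  proof (intro sum.mono_neutral_right ballI)
    fix c assume c: "c \<in> highway_vertices h m Q p - ?R"
    then have "c \<noteq> Row \<sigma> i 0" if "i < m" for \<sigma> i using that by (auto simp: image_iff)
    then show "highway_pot h S c * highway_rhs h S c = 0"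
      using c by (cases c) auto
  qed auto
  also have "\<dots> = (\<Sum>i<m. 2 * (real (pot h 0) * real (flow h 0)))"
    unfolding sum_rows by (intro sum.cong refl) (auto simp: sgn_of_def)
  finally show ?thesis by simp
qed

text \<open>All edges but the rungs of the last column are dropped; each of these occurs in both
  orders, hence the factor 2.\<close>

lemma highway_rung_energy_le:
  fixes x :: "vertex \<Rightarrow> real"
  shows "2 * (\<Sum>i<m. \<Sum>\<sigma>\<in>UNIV. real (10 * 2 ^ h) * (x (Row \<sigma> i (2 ^ h - 1)) - x (Tree 0 (2 ^ h
      - 1)))\<^sup>2)
    \<le> (\<Sum>a\<in>highway_vertices h m Q p. \<Sum>c\<in>highway_vertices h m Q p.
          real (highway_edge h a c + highway_edge h c a) * (x a - x c)\<^sup>2)"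
proof -
  let ?V = "highway_vertices h m Q p"
  let ?R = "(\<lambda>(\<sigma>, i). Row \<sigma> i (2 ^ h - 1)) ` (UNIV \<times> {..<m})"
  let ?hub = "Tree 0 (2 ^ h - 1)"
  have "(\<Sum>a\<in>?R. real (highway_edge h a ?hub) * (x a - x ?hub)\<^sup>2)
    \<le> (\<Sum>a\<in>?V. real (highway_edge h a ?hub) * (x a - x ?hub)\<^sup>2)"
    by (intro sum_mono2) auto
  also have "\<dots> \<le> (\<Sum>a\<in>?V. \<Sum>c\<in>?V. real (highway_edge h a c) * (x a - x c)\<^sup>2)"
    by (intro sum_mono member_le_sum) auto
  finally have 1: "(\<Sum>i<m. \<Sum>\<sigma>\<in>UNIV. real (10 * 2 ^ h) * (x (Row \<sigma> i (2 ^ h - 1)) - x ?hub)\<^sup>2)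
      \<le> (\<Sum>a\<in>?V. \<Sum>c\<in>?V. real (highway_edge h a c) * (x a - x c)\<^sup>2)"
    unfolding sum_rows by (simp add: rung_def UNIV_bool add.commute)
  have "(\<Sum>a\<in>?V. \<Sum>c\<in>?V. real (highway_edge h a c + highway_edge h c a) * (x a - x c)\<^sup>2)
    = (\<Sum>a\<in>?V. \<Sum>c\<in>?V. real (highway_edge h a c) * (x a - x c)\<^sup>2)
      + (\<Sum>a\<in>?V. \<Sum>c\<in>?V. real (highway_edge h c a) * (x a - x c)\<^sup>2)"
    by (simp add: sum.distrib algebra_simps)
  also have "(\<Sum>a\<in>?V. \<Sum>c\<in>?V. real (highway_edge h c a) * (x a - x c)\<^sup>2)
    = (\<Sum>a\<in>?V. \<Sum>c\<in>?V. real (highway_edge h a c) * (x a - x c)\<^sup>2)"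
    by (subst sum.swap) (simp add: power2_commute)
  finally show ?thesis using 1 by simp
qed

section \<open>Rounds on the highway network\<close>

text \<open>A tree node stays in the region as long as some column below it is at least
  \<open>t + 1\<close>. Hence the root stays while \<open>t + 1 < 2 ^ h\<close>, and the tail and
  the pendants never have to leave.\<close>

fun region :: "nat \<Rightarrow> vertex \<Rightarrow> bool" where
  "region t (Row \<sigma> i j) \<longleftrightarrow> t + 1 \<le> j"
| "region t (Tree e k) \<longleftrightarrow> (t + 1) div 2 ^ e \<le> k"
| "region t _ \<longleftrightarrow> True"

text \<open>Its absolute value is the length of a path to the root. The tail counts negatively, so
  that the difference between its end and a row realises the diameter.\<close>

fun level :: "nat \<Rightarrow> vertex \<Rightarrow> int" where
  "level h (Row \<sigma> i j) = int h + 1"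
| "level h (Tree e k) = int h - int e"
| "level h (Tail q) = - int q - 1"
| "level h (Pendant r) = 1"

lemma region_Suc: "region (Suc t) a \<Longrightarrow> region t a"
proof (cases a)
  case (Tree e k)
  have "(t + 1) div 2 ^ e \<le> (Suc t + 1) div 2 ^ e" by (rule div_le_mono) simp
  moreover assume "region (Suc t) a"
  ultimately show ?thesis unfolding Tree region.simps by (rule order_trans)
qed auto

text \<open>
  Only the tree is traversed faster than one column per round, and on each of its levels only the
  last node that has already dropped out of the region can have a parent in it.
\<close>

lemma region_crossing:
  assumes edge: "0 < highway_edge h a c + highway_edge h c a"
    and V: "a \<in> highway_vertices h m Q p" "c \<in> highway_vertices h m Q p"
    and t: "t + 1 < 2 ^ h" and c: "region (Suc t) c" and a: "\<not> region t a"
  shows "\<exists>e<h. a = Tree e (2 * ((t + 2) div 2 ^ Suc e)) \<and> c = Tree (Suc e) ((t + 2) div 2 ^ Suc e)"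
proof (cases "highway_edge h a c = 0")
  case False
  show ?thesis
  proof (cases a)
    case (Row \<sigma> i j)
    then show ?thesis using False a c by (cases c) (auto split: if_splits)
  next
    case (Tree e k)
    show ?thesis
    proof (cases c)
      case (Tree e' k')
      then have ek: "e' = Suc e" "k' = k div 2" using False \<open>a = Tree e k\<close>
          by (auto split: if_splits)
      \<comment> \<open>\<open>k < q\<close> and \<open>q div 2 \<le> k div 2\<close> leave only an
        even \<open>k\<close> with \<open>q = k + 1\<close>.\<close>
      define q where "q = (t + 2) div 2 ^ e"
      have q2: "(t + 2) div 2 ^ Suc e = q div 2"
        by (simp only: power_Suc2 div_mult2_eq q_def)
      have "k < (t + 1) div 2 ^ e" using a \<open>a = Tree e k\<close> by simp
      also have "\<dots> \<le> q" unfolding q_def by (rule div_le_mono) simp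
      finally have "k < q" .
      moreover have "q div 2 \<le> k div 2" using c Tree ek q2 by simp
      ultimately have "k = 2 * (q div 2)" "k div 2 = q div 2" by presburger+
      moreover have "e < h" using V Tree ek by simp
      ultimately show ?thesis using \<open>a = Tree e k\<close> Tree ek q2 by auto
    next
      case (Tail r)
      then have "e = h" using False \<open>a = Tree e k\<close> by (auto split: if_splits)
      then show ?thesis using a t \<open>a = Tree e k\<close> by simp
    next
      case (Pendant r)
      then have "e = h" using False \<open>a = Tree e k\<close> by (auto split: if_splits)
      then show ?thesis using a t \<open>a = Tree e k\<close> by simp
    qed (use False \<open>a = Tree e k\<close> in simp)
  qed (use a in auto)
next
  case True
  then have ca: "highway_edge h c a \<noteq> 0" using edge by simp
  \<comment> \<open>In this orientation \<open>a\<close> is the next column, the leaf, the parent,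
    or a tail or pendant vertex seen from \<open>c\<close>; each of these belongs to the region
    together with \<open>c\<close>.\<close>
  have False
  proof (cases c)
    case (Row \<sigma> i j)
    then show False using ca a c by (cases a) (auto split: if_splits)
  next
    case (Tree e k)
    show False
    proof (cases a)
      case (Tree e' k')
      then have ek: "e' = Suc e" "k' = k div 2" using ca \<open>c = Tree e k\<close> by (auto split: if_splits)
      have "(t + 1) div 2 ^ Suc e = (t + 1) div 2 ^ e div 2" by (simp only: power_Suc2 div_mult2_eq)
      also have "\<dots> \<le> k div 2" using region_Suc[OF c] \<open>c = Tree e k\<close> by (intro div_le_mono) simp
      finally show False using a Tree ek by simp
    qed (use ca a \<open>c = Tree e k\<close> in auto)
  next
    case (Tail r)
    then show False using ca a by (cases a) auto
  next
    case (Pendant r)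
    then show False using ca by (cases a) auto
  qed
  then show ?thesis ..
qed

text \<open>\<open>h < Q\<close> makes the tail at least as long as the way from the root to a row,
  so that no two rows are further apart than \<open>Q + h + 1\<close>. The bound on \<open>n\<close>
  keeps the weights polynomial.\<close>

locale highway =
  fixes h m Q p n :: nat and enc :: "nat \<Rightarrow> vertex"
  assumes enc: "bij_betw enc {..<n} (highway_vertices h m Q p)"
    and m: "0 < m" and Q: "h < Q" and n: "111 * 2 ^ h * 2 ^ h \<le> n ^ 2"
begin

abbreviation "V \<equiv> highway_vertices h m Q p"

definition dec :: "vertex \<Rightarrow> nat" where
  "dec = inv_into {..<n} enc"

definition G :: network where
  "G = \<lparr>nverts = n, ident = id,
        wt = (\<lambda>u v. highway_edge h (enc u) (enc v) + highway_edge h (enc v) (enc u))\<rparr>"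

definition rhs :: "nat set \<Rightarrow> nat \<Rightarrow> int" where
  "rhs S v = highway_rhs h S (enc v)"

definition R :: "nat \<Rightarrow> nat set" where
  "R t = {v. v < n \<and> region t (enc v)}"

lemma G_simps [simp]: "nverts G = n" "ident G = id"
  "wt G u v = highway_edge h (enc u) (enc v) + highway_edge h (enc v) (enc u)"
  by (simp_all add: G_def)

lemma enc_in [simp]: "v < n \<Longrightarrow> enc v \<in> V"
  using enc by (auto simp: bij_betw_def)

lemma enc_dec [simp]: "a \<in> V \<Longrightarrow> enc (dec a) = a"
  using bij_betw_inv_into_right[OF enc] by (simp add: dec_def)

lemma dec_enc [simp]: "v < n \<Longrightarrow> dec (enc v) = v"
  using bij_betw_inv_into_left[OF enc] by (simp add: dec_def)

lemma dec_less [simp]: "a \<in> V \<Longrightarrow> dec a < n"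
  using bij_betw_inv_into[OF enc] by (auto simp: dec_def bij_betw_def)

lemma sum_enc: "(\<Sum>v<n. f (enc v)) = (\<Sum>a\<in>V. f a)"
  by (rule sum.reindex_bij_betw[OF enc])

definition E :: "(vertex \<times> vertex) set" where
  "E = {(a, c). a \<in> V \<and> c \<in> V \<and> 0 < highway_edge h a c + highway_edge h c a}"

lemma sym_E: "sym E"
  by (auto simp: sym_def E_def)

lemma relpow_dec: "(a, c) \<in> E ^^ k \<Longrightarrow> (dec a, dec c) \<in> edge_rel G ^^ k"
proof (induction k arbitrary: c)
  case (Suc k)
  then obtain d where d: "(a, d) \<in> E ^^ k" "(d, c) \<in> E" by auto
  then have "(dec d, dec c) \<in> edge_rel G" by (auto simp: E_def edge_rel_def adjacent_def)
  with Suc.IH[OF d(1)] show ?case by auto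
qed simp

lemma reach_root_Tree:
  assumes "d \<le> h" "k < 2 ^ d"
  shows "(Tree (h - d) k, Tree h 0) \<in> E ^^ d"
  using assms
proof (induction d arbitrary: k)
  case (Suc d)
  have "h - d = Suc (h - Suc d)" using Suc.prems by simp
  then have "(Tree (h - Suc d) k, Tree (h - d) (k div 2)) \<in> E"
    using Suc.prems by (auto simp: E_def less_mult_imp_div_less mult.commute)
  moreover have "(Tree (h - d) (k div 2), Tree h 0) \<in> E ^^ d"
    using Suc.prems by (intro Suc.IH) (auto simp: less_mult_imp_div_less mult.commute)
  ultimately show ?case by (rule relpow_Suc_I2)
qed simp

lemma Tail_path: "q + k < Q \<Longrightarrow> (Tail (q + k), Tail q) \<in> E ^^ k"
proof (induction k)
  case (Suc k)
  then have "(Tail (q + k), Tail q) \<in> E ^^ k" "(Tail (q + Suc k), Tail (q + k)) \<in> E"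
    by (auto simp: E_def)
  then show ?case by (meson relpow_Suc_I2)
qed simp

lemma reach_root:
  assumes "a \<in> V"
  shows "(a, Tree h 0) \<in> E ^^ nat \<bar>level h a\<bar>"
proof (cases a)
  case (Row \<sigma> i j)
  then have "(a, Tree 0 j) \<in> E" using assms by (auto simp: E_def rung_def)
  moreover have "(Tree 0 j, Tree h 0) \<in> E ^^ h" using reach_root_Tree[of h j] assms Row by simp
  ultimately have "(a, Tree h 0) \<in> E ^^ Suc h" by (rule relpow_Suc_I2)
  then show ?thesis by (simp add: Row nat_add_distrib)
next
  case (Tree e k)
  then show ?thesis using reach_root_Tree[of "h - e" k] assms by (simp add: nat_diff_distrib)
next
  case (Tail q)
  have "(a, Tail 0) \<in> E ^^ q" using Tail_path[of 0 q] Tail assms by simp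
  moreover have "(Tail 0, Tree h 0) \<in> E" using Tail assms by (auto simp: E_def)
  ultimately have "(a, Tree h 0) \<in> E ^^ Suc q" by (rule relpow_Suc_I)
  then show ?thesis by (simp add: Tail nat_add_distrib)
next
  case (Pendant r)
  then show ?thesis using assms by (auto simp: E_def)
qed

lemma reach:
  assumes "a \<in> V" "c \<in> V"
  shows "\<exists>k\<le>Q + h + 1. (a, c) \<in> E ^^ k"
\<comment> \<open>Two tail vertices are joined along the tail, as the detour through the root can be
  too long; all other pairs meet at the root.\<close>
proof (cases "\<exists>q r. a = Tail q \<and> c = Tail r")
  case True
  then obtain q r where ac: "a = Tail q" "c = Tail r" by blast
  show ?thesis
  proof (cases "q \<le> r")
    case True
    then have "(c, a) \<in> E ^^ (r - q)" using Tail_path[of q "r - q"] assms ac by simp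
    then show ?thesis using relpow_sym[OF sym_E] assms ac by (intro exI[of _ "r - q"]) auto
  next
    case False
    then have "(a, c) \<in> E ^^ (q - r)" using Tail_path[of r "q - r"] assms ac by simp
    then show ?thesis using assms ac by (intro exI[of _ "q - r"]) auto
  qed
next
  case False
  have "(a, c) \<in> E ^^ (nat \<bar>level h a\<bar> + nat \<bar>level h c\<bar>)"
    unfolding relpow_add using reach_root[OF assms(1)] relpow_sym[OF sym_E reach_root[OF assms(2)]]
        by blast
  moreover have "nat \<bar>level h a\<bar> + nat \<bar>level h c\<bar> \<le> Q + h + 1"
    using assms False Q by (cases a; cases c) auto
  ultimately show ?thesis by blast
qed

lemma reach_G: "u < n \<Longrightarrow> v < n \<Longrightarrow> \<exists>k\<le>Q + h + 1. (u, v) \<in> edge_rel G ^^ k"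
  using reach[of "enc u" "enc v"] relpow_dec[of "enc u" "enc v"] by fastforce

lemma level_lipschitz:
  assumes "a \<in> V" "c \<in> V" "0 < highway_edge h a c"
  shows "\<bar>level h a - level h c\<bar> \<le> 1"
  using assms by (cases a; cases c) (auto split: if_splits)

lemma diam_G: "diam G = Q + h + 1"
proof (rule diam_eqI[where \<phi> = "level h \<circ> enc" and a = "dec (Tail (Q - 1))"
    and b = "dec (Row True 0 0)"])
  show "\<exists>k\<le>Q + h + 1. (u, v) \<in> edge_rel G ^^ k" if "u < nverts G" "v < nverts G" for u v
    using reach_G that by simp
  show "\<bar>(level h \<circ> enc) u - (level h \<circ> enc) v\<bar> \<le> 1" if "adjacent G u v" for u v
    using that level_lipschitz[of "enc u" "enc v"] level_lipschitz[of "enc v" "enc u"]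
    by (auto simp: adjacent_def abs_minus_commute)
  show "dec (Tail (Q - 1)) < nverts G" "dec (Row True 0 0) < nverts G"
    "(level h \<circ> enc) (dec (Row True 0 0)) - (level h \<circ> enc) (dec (Tail (Q - 1))) = int (Q + h + 1)"
    using Q m by simp_all
qed

lemma edge_bound: "highway_edge h a c + highway_edge h c a \<le> 111 * 2 ^ h * 2 ^ h"
proof -
  have 1: "1 \<le> (2::nat) ^ h" by simp
  then have "10 \<le> 111 * (2::nat) ^ h" by linarith
  then have 2: "10 * 2 ^ h \<le> 111 * 2 ^ h * (2 ^ h :: nat)" by simp
  then have 3: "Suc 0 \<le> 111 * 2 ^ h * 2 ^ h" using 1 by linarith
  then show ?thesis using 2 flow_le by (cases a; cases c) (auto simp: rung_def)
qed

lemma n_pos: "0 < n"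
  using n by (cases n) auto

lemma n_pow: "2 \<le> \<kappa> \<Longrightarrow> 111 * 2 ^ h * 2 ^ h \<le> n ^ \<kappa>"
  using n power_increasing[of 2 \<kappa> n] n_pos by simp

lemma valid_G:
  assumes "2 \<le> \<kappa>"
  shows "valid_network \<kappa> G"
proof -
  have "n \<le> n ^ \<kappa>" using assms n_pos by (intro self_le_power) auto
  moreover have "(u, v) \<in> (edge_rel G)\<^sup>*" if "u < n" "v < n" for u v
    using reach_G[OF that] by (auto simp: rtrancl_power)
  moreover have "highway_edge h a a = 0" for a by (cases a) auto
  moreover have "wt G u v \<le> n ^ \<kappa>" for u v
    using edge_bound[of "enc u" "enc v"] n_pow[OF assms] by simp
  ultimately show ?thesis using n_pos
    by (auto simp: valid_network_def add.commute intro: order.strict_trans2)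
qed

lemma valid_rhs_G:
  assumes "2 \<le> \<kappa>"
  shows "valid_rhs \<kappa> G (rhs S)"
proof -
  have "flow h 0 \<le> n ^ \<kappa>" using flow_le[of h 0] n_pow[OF assms] by linarith
  then have *: "int (flow h 0) \<le> int n ^ \<kappa>" by (simp flip: of_nat_power)
  have "\<bar>highway_rhs h S a\<bar> \<le> int n ^ \<kappa>" for a
    using * by (cases a) (auto simp: sgn_of_def)
  then show ?thesis by (simp add: valid_rhs_def rhs_def)
qed

section \<open>Transcripts and sign patterns on the highway\<close>

lemma R_antimono: "R (Suc t) \<subseteq> R t"
  by (auto simp: R_def region_Suc)

text \<open>Current is injected only in column 0, which lies outside \<open>R 0\<close>.\<close>

lemma rhs_eq_on_R: "v \<in> R 0 \<Longrightarrow> rhs S v = rhs S' v"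
  by (cases "enc v") (auto simp: R_def rhs_def)

text \<open>By \<open>region_crossing\<close> the round and the tree level determine the crossing
  edge.\<close>

lemma card_crossing:
  assumes T: "T + 1 < 2 ^ h"
  shows "finite (crossing G R T)" "card (crossing G R T) \<le> T * h"
proof -
  let ?f = "\<lambda>(t, e). (t, dec (Tree e (2 * ((t + 2) div 2 ^ Suc e))), dec (Tree (Suc e) ((t
      + 2) div 2 ^ Suc e)))"
  have sub: "crossing G R T \<subseteq> ?f ` ({..<T} \<times> {..<h})"
  proof
    fix z assume "z \<in> crossing G R T"
    then obtain t u v where z: "z = (t, u, v)"
        and tuv: "t < T" "adjacent G u v" "v \<in> R (Suc t)" "u \<notin> R t"
      by (auto simp: crossing_def)
    have uv: "u < n" "v < n" using tuv by (auto simp: adjacent_def)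
    obtain e where e: "e < h" "enc u = Tree e (2 * ((t + 2) div 2 ^ Suc e))"
        "enc v = Tree (Suc e) ((t + 2) div 2 ^ Suc e)"
      using region_crossing[of h "enc u" "enc v" m Q p t] tuv uv T
      by (auto simp: adjacent_def R_def)
    then have "u = dec (Tree e (2 * ((t + 2) div 2 ^ Suc e)))" "v = dec (Tree (Suc e) ((t
        + 2) div 2 ^ Suc e))"
      using uv by (metis dec_enc)+
    then show "z \<in> ?f ` ({..<T} \<times> {..<h})" using z e tuv by (intro image_eqI[of _ _ "(t, e)"]) auto
  qed
  show "finite (crossing G R T)" by (rule finite_subset[OF sub]) simp
  have "card (crossing G R T) \<le> card (?f ` ({..<T} \<times> {..<h}))" by (rule card_mono[OF _ sub]) simp
  also have "\<dots> \<le> card ({..<T} \<times> {..<h})" by (rule card_image_le) simp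
  finally show "card (crossing G R T) \<le> T * h" by simp
qed

lemma rung_error:
  fixes x :: "real vec" and z :: "bool \<Rightarrow> nat \<Rightarrow> real"
  assumes sol: "laplacian_solution \<epsilon> G (rhs S) x" "dim_vec x = n" and eps: "\<epsilon> \<le> 1/2"
    and z: "\<And>\<sigma> i. z \<sigma> i = x $ dec (Row \<sigma> i (2 ^ h - 1)) - x $ dec (Tree 0 (2 ^ h - 1))"
  shows "(\<Sum>i<m. \<Sum>\<sigma>\<in>UNIV. (z \<sigma> i - sgn_of S \<sigma> i * real (10 * 2 ^ h))\<^sup>2)
    \<le> real m * (1221 * 2 ^ h * 2 ^ h / 20)"
proof -
  define er where "er a = x $ dec a - highway_pot h S a" for a
  have "(\<Sum>u<nverts G. \<Sum>v<nverts G. real (wt G u v) *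
      ((x $ u - highway_pot h S (enc u)) - (x $ v - highway_pot h S (enc v)))\<^sup>2)
    \<le> (\<Sum>v<nverts G. highway_pot h S (enc v) * rhs S v) / 2"
  proof (rule laplacian_solution_energy[OF valid_G[of 2] _ _ sol(1) eps])
    fix v assume "v < nverts G"
    then show "(\<Sum>u<nverts G. real (wt G v u) * (highway_pot h S (enc v) - highway_pot h S (enc u)))
        = rhs S v"
      using highway_pot_laplacian[of "enc v" h m Q p S]
        sum_enc[of "\<lambda>c. real (highway_edge h (enc v) c + highway_edge h c (enc v)) *
          (highway_pot h S (enc v) - highway_pot h S c)"]
      by (simp add: rhs_def)
  qed (use sol in auto)
  also have "(\<Sum>v<nverts G. highway_pot h S (enc v) * rhs S v) = 2 * real m * pot h 0 * flow h 0"
    using highway_total_energy[of h S m Q p] sum_enc[of "\<lambda>c. highway_pot h S c * highway_rhs h S c"]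
    by (simp add: rhs_def)
  also have "(\<Sum>u<nverts G. \<Sum>v<nverts G. real (wt G u v) *
      ((x $ u - highway_pot h S (enc u)) - (x $ v - highway_pot h S (enc v)))\<^sup>2)
    = (\<Sum>u<n. \<Sum>v<n. real (highway_edge h (enc u) (enc v)
        + highway_edge h (enc v) (enc u)) * (er (enc u) - er (enc v))\<^sup>2)"
    by (simp add: er_def)
  also have "\<dots> = (\<Sum>a\<in>V. \<Sum>c\<in>V. real (highway_edge h a c + highway_edge h c a) * (er a - er c)\<^sup>2)"
    unfolding sum_enc[of "\<lambda>c. real (highway_edge h (enc _) c
        + highway_edge h c (enc _)) * (er (enc _) - er c)\<^sup>2"]
    by (rule sum_enc)
  finally have *: "(\<Sum>a\<in>V. \<Sum>c\<in>V. real (highway_edge h a c + highway_edge h c a) * (er a - er c)\<^sup>2)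
      \<le> real m * pot h 0 * flow h 0" by simp
  have er: "er (Row \<sigma> i (2 ^ h - 1)) - er (Tree 0 (2 ^ h - 1)) = z \<sigma> i
      - sgn_of S \<sigma> i * real (10 * 2 ^ h)" for \<sigma> i
    by (simp add: er_def z pot_def)
  let ?s = "\<Sum>i<m. \<Sum>\<sigma>\<in>UNIV. (z \<sigma> i - sgn_of S \<sigma> i * real (10 * 2 ^ h))\<^sup>2"
  \<comment> \<open>20 is the rung factor 10 in both orders; 1221 is 11 times 111, from the bounds
    on potential and flow in column 0.\<close>
  have "20 * 2 ^ h * ?s = 2 * (\<Sum>i<m. \<Sum>\<sigma>\<in>UNIV. real (10 * 2 ^ h) * (er (Row \<sigma> i (2 ^ h - 1))
      - er (Tree 0 (2 ^ h - 1)))\<^sup>2)"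
    unfolding er by (simp add: sum_distrib_left mult_ac)
  also have "\<dots> \<le> real m * (pot h 0 * flow h 0)"
    using highway_rung_energy_le[of h er m Q p] * by (simp add: mult_ac)
  also have "\<dots> \<le> real m * real ((11 * 2 ^ h) * (111 * 2 ^ h * 2 ^ h))"
    using flow_le[of h 0] unfolding of_nat_mult[symmetric] of_nat_le_iff
    by (intro mult_mono) (auto simp: pot_def)
  also have "\<dots> = 20 * 2 ^ h * (real m * (1221 * 2 ^ h * 2 ^ h / 20))" by simp
  finally show ?thesis by simp
qed

text \<open>Where \<open>S\<close> and \<open>S'\<close> differ, a common reading is off by squares
  that sum to at least \<open>2 * F\<^sup>2\<close> on each of two rows, that is
  \<open>400 * 4 ^ h\<close> per index. The joint error budget is \<open>122.1 * m * 4 ^ h\<close>,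
  and 122.1/400 is below 1/3.\<close>

lemma hamming_le:
  fixes x x' :: "real vec"
  assumes sol: "laplacian_solution \<epsilon> G (rhs S) x" "laplacian_solution \<epsilon> G (rhs S') x'"
    and dim: "dim_vec x = n" "dim_vec x' = n" and eps: "\<epsilon> \<le> 1/2"
    and eq: "\<And>\<sigma> i. i < m \<Longrightarrow> x $ dec (Row \<sigma> i (2 ^ h - 1)) = x' $ dec (Row \<sigma> i (2 ^ h - 1))"
      "x $ dec (Tree 0 (2 ^ h - 1)) = x' $ dec (Tree 0 (2 ^ h - 1))"
    and S: "S \<subseteq> {..<m}" "S' \<subseteq> {..<m}"
  shows "real (card (sym_diff S S')) \<le> real m / 3"
proof -
  define z where "z \<sigma> i = x $ dec (Row \<sigma> i (2 ^ h - 1)) - x $ dec (Tree 0 (2 ^ h - 1))" for \<sigma> i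
  define z' where "z' \<sigma> i = x' $ dec (Row \<sigma> i (2 ^ h - 1)) - x' $ dec (Tree 0 (2 ^ h - 1))" for \<sigma> i
  define F where "F = real (10 * 2 ^ h)"
  have zz: "z' \<sigma> i = z \<sigma> i" if "i < m" for \<sigma> i using eq that by (simp add: z_def z'_def)
  have 1: "(\<Sum>i<m. \<Sum>\<sigma>\<in>UNIV. (z \<sigma> i - sgn_of S \<sigma> i * F)\<^sup>2) \<le> real m * (1221 * 2 ^ h * 2 ^ h / 20)"
    unfolding F_def by (rule rung_error[OF sol(1) dim(1) eps]) (simp add: z_def)
  have "(\<Sum>i<m. \<Sum>\<sigma>\<in>UNIV. (z' \<sigma> i - sgn_of S' \<sigma> i * F)\<^sup>2) \<le> real m * (1221 * 2 ^ h * 2 ^ h / 20)"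
    unfolding F_def by (rule rung_error[OF sol(2) dim(2) eps]) (simp add: z'_def)
  then have 2: "(\<Sum>i<m. \<Sum>\<sigma>\<in>UNIV. (z \<sigma> i - sgn_of S' \<sigma> i * F)\<^sup>2)
      \<le> real m * (1221 * 2 ^ h * 2 ^ h / 20)"
    by (simp add: zz)
  have two: "2 * F\<^sup>2 \<le> (y - sgn_of S \<sigma> i * F)\<^sup>2 + (y - sgn_of S' \<sigma> i * F)\<^sup>2"
    if "i \<in> sym_diff S S'" for y \<sigma> i
  proof -
    have "(y - F)\<^sup>2 + (y + F)\<^sup>2 = 2 * F\<^sup>2 + 2 * y\<^sup>2" by (simp add: power2_eq_square algebra_simps)
    then have "2 * F\<^sup>2 \<le> (y - F)\<^sup>2 + (y + F)\<^sup>2" by simp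
    then show ?thesis using that by (auto simp: sgn_of_def add.commute)
  qed
  have fin: "finite (sym_diff S S')" using S by (auto intro: finite_subset)
  have "real (card (sym_diff S S')) * (4 * F\<^sup>2) = (\<Sum>i\<in>sym_diff S S'. \<Sum>\<sigma>\<in>(UNIV::bool set). 2 * F\<^sup>2)"
    by simp
  also have "\<dots> \<le> (\<Sum>i\<in>sym_diff S S'. \<Sum>\<sigma>\<in>UNIV. (z \<sigma> i - sgn_of S \<sigma> i * F)\<^sup>2 + (z \<sigma> i
      - sgn_of S' \<sigma> i * F)\<^sup>2)"
    by (intro sum_mono two)
  also have "\<dots> \<le> (\<Sum>i<m. \<Sum>\<sigma>\<in>UNIV. (z \<sigma> i - sgn_of S \<sigma> i * F)\<^sup>2 + (z \<sigma> i - sgn_of S' \<sigma> i * F)\<^sup>2)"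
    using S by (intro sum_mono2) (auto intro!: sum_nonneg)
  also have "\<dots> \<le> 2 * (real m * (1221 * 2 ^ h * 2 ^ h / 20))"
    using 1 2 by (simp add: sum.distrib)
  finally have "real (card (sym_diff S S')) * 400 * (2 ^ h)\<^sup>2 \<le> real m * (1221 / 10) * (2 ^ h)\<^sup>2"
    by (simp add: F_def power2_eq_square mult_ac)
  then have "real (card (sym_diff S S')) * 400 \<le> real m * (1221 / 10)"
    by (rule mult_right_le_imp_le) simp
  then show ?thesis by simp
qed

text \<open>Some choice of coins serves two thirds of all sign patterns. The patterns that share a
  transcript lie in one Hamming ball, so there must be many transcripts.\<close>

lemma counting_bound:
  assumes A: "congest \<beta> A" and K: "\<beta> * log 2 (real n) < real K + 1"
    and sol: "solves_laplacian_within \<kappa> \<epsilon> A T" and eps: "\<epsilon> \<le> 1/2" and \<kappa>: "2 \<le> \<kappa>"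
    and T: "T n (Q + h + 1) + 1 < 2 ^ h"
  shows "2/3 * 2 ^ m \<le> 2 ^ ((K + 1) * (T n (Q + h + 1) * h)) * ((3/2) ^ m * 2 powr (real m / 3))"
proof -
  let ?T = "T n (Q + h + 1)"
  have "\<forall>S. \<exists>X\<in>sets coin_measure. measure coin_measure X \<ge> 2/3 \<and>
       (\<forall>\<omega>\<in>X. finishes_within A G (rhs S) \<omega> ?T \<and>
          laplacian_solution \<epsilon> G (rhs S) (result A G (rhs S) \<omega>))"
    using sol valid_G[OF \<kappa>] valid_rhs_G[OF \<kappa>] unfolding solves_laplacian_within_def
    by (metis G_simps(1) diam_G)
  then obtain X where X: "\<And>S. X S \<in> sets coin_measure" "\<And>S. 2/3 \<le> measure coin_measure (X S)"
    and ok: "\<And>S \<omega>. \<omega> \<in> X S \<Longrightarrow> finishes_within A G (rhs S) \<omega> ?T"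
      "\<And>S \<omega>. \<omega> \<in> X S \<Longrightarrow> laplacian_solution \<epsilon> G (rhs S) (result A G (rhs S) \<omega>)"
    by metis
  interpret prob_space coin_measure by (rule prob_space_coin_measure)
  obtain \<omega> where \<omega>: "2/3 * card (Pow {..<m}) \<le> card {S \<in> Pow {..<m}. \<omega> \<in> X S}"
    using exists_point_in_many_events[of "Pow {..<m}" X "2/3"] X by auto
  define good where "good = {S \<in> Pow {..<m}. \<omega> \<in> X S}"
  define tr where "tr S = transcript A G R \<omega> ?T (rhs S)" for S
  have fin: "finite good" by (simp add: good_def)
  have close: "real (card (sym_diff S S')) \<le> real m / 3"
      if S: "S \<in> good" "S' \<in> good" "tr S' = tr S" for S S'
  proof -
    have res: "result A G (rhs S) \<omega> $ v = result A G (rhs S') \<omega> $ v" if "v \<in> R ?T" for v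
      by (rule result_eq_if_transcript_eq[of ?T R])
        (use S that R_antimono rhs_eq_on_R ok in \<open>auto simp: tr_def good_def R_def\<close>)
    \<comment> \<open>The last column, index \<open>2 ^ h - 1\<close>, is still in the region after
      the last round.\<close>
    have "?T + 1 \<le> 2 ^ h - 1" using T by simp
    then have "dec (Row \<sigma> i (2 ^ h - 1)) \<in> R ?T" "dec (Tree 0 (2 ^ h - 1)) \<in> R ?T"
        if "i < m" for \<sigma> i
      using that by (simp_all add: R_def)
    then show ?thesis using S m ok
      by (intro hamming_le[of \<epsilon> S "result A G (rhs S) \<omega>" S' "result A G (rhs S') \<omega>"] eps res)
        (auto simp: good_def result_def)
  qed
  have "card (tr ` good) \<le> 2 ^ ((K + 1) * (?T * h))"
    using card_transcripts[of \<beta> A G K R ?T "?T * h" \<omega> "rhs ` good"] A K card_crossing[OF T]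
    by (simp add: tr_def[abs_def] image_image)
  then have "real (card good) \<le> real (2 ^ ((K + 1) * (?T * h))) * ((3/2) ^ m * 2 powr (real m / 3))"
  proof (rule card_le_fibres[OF fin])
    fix S assume S: "S \<in> good"
    show "real (card {S' \<in> good. tr S' = tr S}) \<le> (3/2) ^ m * 2 powr (real m / 3)"
      by (rule card_hamming_ball[of S]) (use S close in \<open>auto simp: good_def\<close>)
  qed simp
  moreover have "2/3 * 2 ^ m \<le> real (card good)" using \<omega> by (simp add: good_def card_Pow)
  ultimately show ?thesis by simp
qed

end

section \<open>The lower bound\<close>

text \<open>Compare exponents of 2: \<open>3/2 \<le> 2 powr (3/5)\<close> since 243/32 is at most 8,
  and 1 - 3/5 - 1/3 = 1/15. The factor 2/3 costs at most one bit.\<close>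

lemma transcript_length_bound:
  assumes "2/3 * 2 ^ m \<le> 2 ^ N * ((3/2) ^ m * 2 powr (real m / 3))"
  shows "real m / 15 - 1 \<le> real N"
proof -
  have "(2 powr (3/5 :: real)) ^ 5 = (2 :: real) powr (real 5 * (3/5))" by (rule powr_power) simp
  also have "\<dots> = 8" by simp
  finally have "(3/2 :: real) ^ 5 \<le> (2 powr (3/5)) ^ 5" by (simp add: power_numeral_reduce)
  then have "(3/2 :: real) \<le> 2 powr (3/5)" by (simp add: power_mono_iff)
  then have "(3/2 :: real) ^ m \<le> (2 powr (3/5)) ^ m" by (rule power_mono) simp
  also have "\<dots> = 2 powr (real m * (3/5))" by (rule powr_power) simp
  finally have base: "(3/2 :: real) ^ m \<le> 2 powr (real m * (3/5))" .
  have "2 powr (real m - 1) \<le> 2/3 * (2::real) ^ m" by (simp add: powr_diff powr_realpow)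
  also have "\<dots> \<le> 2 ^ N * ((3/2) ^ m * 2 powr (real m / 3))" by (rule assms)
  also have "\<dots> \<le> 2 powr real N * (2 powr (real m * (3/5)) * 2 powr (real m / 3))"
    using base by (simp add: powr_realpow)
  also have "\<dots> = 2 powr (real N + (real m * (3/5) + real m / 3))" by (simp only: powr_add)
  finally have "real m - 1 \<le> real N + (real m * (3/5) + real m / 3)" by simp
  then show ?thesis by simp
qed

lemma exists_tree_height:
  assumes "4 \<le> n"
  shows "\<exists>h. 4 ^ Suc h \<le> n \<and> n < (4::nat) ^ Suc (Suc h)"
proof -
  have bd: "y \<le> n" if "4 ^ y \<le> n" for y
  proof -
    have "y < (2::nat) ^ y" by (rule less_exp)
    also have "\<dots> \<le> 4 ^ y" by (rule power_mono) auto
    finally show ?thesis using that by simp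
  qed
  define k where "k = (GREATEST k. 4 ^ k \<le> n)"
  have k: "4 ^ k \<le> n" unfolding k_def
    by (rule GreatestI_nat[where P = "\<lambda>k. 4 ^ k \<le> n"
      and k = 1 and b = n]) (use assms in \<open>auto intro: bd\<close>)
  have max: "j \<le> k" if "4 ^ j \<le> n" for j unfolding k_def
    by (rule Greatest_le_nat[where P = "\<lambda>k. 4 ^ k \<le> n" and b = n]) (use that in \<open>auto intro: bd\<close>)
  have "1 \<le> k" using max[of 1] assms by simp
  then obtain h where h: "k = Suc h" by (cases k) auto
  have "\<not> 4 ^ Suc k \<le> n" using max[of "Suc k"] by auto
  then show ?thesis using k by (intro exI[of _ h]) (simp add: h not_le)
qed

lemma highway_rounds:
  fixes D n :: nat and T :: "nat \<Rightarrow> nat \<Rightarrow> nat"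
  assumes A: "congest \<beta> A" and sol: "solves_laplacian_within \<kappa> \<epsilon> A T" and eps: "\<epsilon> \<le> 1/2" and \<kappa>: "2
      \<le> \<kappa>"
    and n: "14400 \<le> n" and D: "2 * ln (real n) \<le> real D" "real D < sqrt (real n)"
  shows "sqrt (real n) \<le> 120 * (2 * \<bar>\<beta>\<bar> + 1) * ln (real n) ^ 2 * T n D"
proof -
  obtain h where h: "4 ^ Suc h \<le> n" "n < 4 ^ Suc (Suc h)" using exists_tree_height[of n] n by auto
  define L where "L = (2::nat) ^ h"
  have LL: "(4::nat) ^ h = L * L" by (simp add: L_def power_mult_distrib[symmetric])
  have hL: "4 * (L * L) \<le> n" "n < 16 * (L * L)" using h by (simp_all add: LL)
  have "real n \<le> (4 * real L)\<^sup>2" using hL(2) by (simp add: power2_eq_square flip: of_nat_mult)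
  then have sqrtL: "sqrt (real n) \<le> 4 * real L" by (intro real_le_lsqrt) auto
  \<comment> \<open>14400 is 120 squared; this makes \<open>L\<close> at least 30, which later
    absorbs additive constants.\<close>
  have "sqrt (real (14400::nat)) \<le> sqrt (real n)" using n by (intro real_sqrt_le_mono) simp
  moreover have "sqrt (real (14400::nat)) = 120" by (rule real_sqrt_unique) auto
  ultimately have sq120: "120 \<le> sqrt (real n)" by simp
  then have L30: "30 \<le> real L" using sqrtL by simp
  have "1 \<le> ln (2 ^ 2 :: real)" using exp_le by (subst ln_ge_iff) auto
  then have ln2: "1/2 \<le> ln (2::real)" using ln_realpow[of 2 2] by simp
  have "ln (2::real) * 2 * (h + 1) = ln (real (4 ^ Suc h))"
    using ln_realpow[of 2 "2 * Suc h"] by (simp add: power_mult)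
  also have "\<dots> \<le> ln (real n)" using h(1) by (intro ln_mono of_nat_mono) auto
  finally have "ln (2::real) * 2 * (h + 1) \<le> ln (real n)" .
  moreover have "1 * real (h + 1) \<le> ln (2::real) * 2 * (h + 1)" using ln2
      by (intro mult_right_mono) auto
  ultimately have "1 * real (h + 1) \<le> ln (real n)" by (rule order_trans[rotated])
  then have hln: "real h + 1 \<le> ln (real n)" by simp
  then have "real (2 * (h + 1)) \<le> real D" using D(1) by simp
  then have hD: "2 * (h + 1) \<le> D" by (simp only: of_nat_le_iff)
  \<comment> \<open>The tail length is dictated by the diameter \<open>Q + h + 1\<close>; the
    logarithmic lower bound on \<open>D\<close> provides \<open>h < Q\<close>.\<close>
  define Q where "Q = D - h - 1"
  have QD: "Q + h + 1 = D" and Qh: "h < Q" using hD by (auto simp: Q_def)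
  have "4 * sqrt (real n) \<le> sqrt (real n) * sqrt (real n)" using sq120
      by (intro mult_right_mono) auto
  then have "real (4 * D) \<le> real n" using D(2) by simp
  then have "4 * D \<le> n" by (simp only: of_nat_le_iff)
  \<comment> \<open>With \<open>m = L\<close> pairs the rows and the tree take at most three
    quarters of the \<open>n\<close> vertices, the tail at most one quarter; pendants fill up the
    rest.\<close>
  then have "2 * L * 2 ^ h + 2 ^ h * 2 ^ h + Q \<le> n" using hL(1) QD by (simp add: L_def)
  then obtain p where p: "card (highway_vertices h L Q p) = n" using exists_highway_vertices
      by blast
  obtain enc where enc: "bij_betw enc {..<n} (highway_vertices h L Q p)"
    using ex_bij_betw_nat_finite[OF finite_highway_vertices[of h L Q p]] p
      by (auto simp: atLeast0LessThan)
  have "111 * (L * L) \<le> 28 * n" using hL(1) by linarith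
  also have "\<dots> \<le> n * n" using n by (intro mult_right_mono) auto
  finally have "111 * 2 ^ h * 2 ^ h \<le> n ^ 2" by (simp add: L_def power2_eq_square)
  then interpret highway h L Q p n enc
    by unfold_locales (use enc Qh in \<open>auto simp: L_def\<close>)
  define B where "B = 2 * \<bar>\<beta>\<bar> + 1"
  define t where "t = T n D"
  have ln1: "1 \<le> ln (real n)" using hln by simp
  have B1: "1 \<le> B" by (simp add: B_def)
  have lnsq: "1 \<le> ln (real n) ^ 2" using ln1 by simp
  have "real L \<le> 30 * B * ln (real n) ^ 2 * t"
  proof (cases "t + 1 < 2 ^ h")
    case True
    \<comment> \<open>The largest integral message length; \<open>nat\<close> makes it 0 when
      \<open>\<beta>\<close> is negative.\<close>
    define K where "K = nat \<lfloor>\<beta> * log 2 (real n)\<rfloor>"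
    have K: "\<beta> * log 2 (real n) < real K + 1" unfolding K_def by linarith
    have "log 2 (real n) \<le> 2 * ln (real n)"
      using ln2 ln1 by (simp add: log_def field_simps)
    then have "\<bar>\<beta>\<bar> * log 2 (real n) \<le> \<bar>\<beta>\<bar> * (2 * ln (real n))" by (intro mult_left_mono) auto
    moreover have "\<beta> * log 2 (real n) \<le> \<bar>\<beta>\<bar> * log 2 (real n)"
      using ln1 by (intro mult_right_mono) (auto simp: log_def)
    moreover have "real K \<le> max 0 (\<beta> * log 2 (real n))" unfolding K_def by linarith
    ultimately have "real K \<le> \<bar>\<beta>\<bar> * (2 * ln (real n))"
      using ln1 by (smt (verit, best) mult_nonneg_nonneg)
    then have KB: "real (K + 1) \<le> B * ln (real n)" using ln1 by (simp add: B_def algebra_simps)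
    have "2/3 * 2 ^ L \<le> 2 ^ ((K + 1) * (t * h)) * ((3/2) ^ L * 2 powr (real L / 3))"
      using counting_bound[OF A K sol eps \<kappa>] True by (simp only: QD t_def)
    then have "real L / 15 - 1 \<le> real ((K + 1) * (t * h))" by (rule transcript_length_bound)
    then have "real L / 30 \<le> real ((K + 1) * (t * h))" using L30 by simp
    also have "\<dots> = real (K + 1) * real h * real t" by (simp only: of_nat_mult mult_ac)
    also have "\<dots> \<le> (B * ln (real n)) * ln (real n) * real t"
      using KB hln ln1 B1 by (intro mult_right_mono mult_mono) auto
    finally show ?thesis by (simp add: power2_eq_square mult_ac)
  next
    \<comment> \<open>So many rounds let the signs travel along the rows, but
      \<open>t \<ge> L - 1\<close> is already of the required order.\<close>
    case False
    then have "real L \<le> real t + 1" by (simp add: L_def flip: of_nat_power)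
    then have "real L \<le> 30 * real t" using L30 by simp
    also have "\<dots> \<le> (30 * (B * ln (real n) ^ 2)) * real t"
      using mult_mono[OF B1 lnsq] B1 by (intro mult_right_mono) auto
    finally show ?thesis by (simp add: mult_ac)
  qed
  then have "4 * real L \<le> 120 * B * ln (real n) ^ 2 * t" by linarith
  then show ?thesis using sqrtL unfolding B_def t_def by linarith
qed

text \<open>Diameters are taken at least logarithmic since the tree alone has logarithmic depth. The
  two lost logarithms are the message length and the number of tree levels crossed per
  round.\<close>

theorem theorem1p2:
  shows "\<exists>(\<kappa>\<^sub>0::nat) (k::nat) (C::real). C > 0 \<and>
    (\<forall>\<kappa>\<ge>\<kappa>\<^sub>0. \<forall>\<beta>::real. \<exists>(c::real) (n\<^sub>0::nat). c > 0 \<and>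
      (\<forall>A \<epsilon> T. congest \<beta> A \<longrightarrow> \<epsilon> \<le> 1/2 \<longrightarrow> solves_laplacian_within \<kappa> \<epsilon> A T \<longrightarrow>
        (\<forall>n\<ge>n\<^sub>0. \<forall>D<n. C * ln (real n) \<le> real D \<longrightarrow>
           real (T n D) \<ge> c * (sqrt (real n) + real D) / ln (real n) ^ k)))"
proof (rule exI[of _ 2], rule exI[of _ 2], rule exI[of _ 2], intro conjI allI impI)
  show "(0::real) < 2" by simp
  fix \<kappa> :: nat and \<beta> :: real assume \<kappa>: "2 \<le> \<kappa>"
  define B where "B = 2 * \<bar>\<beta>\<bar> + 1"
  have B: "1 \<le> B" by (simp add: B_def)
  show "\<exists>c n\<^sub>0. 0 < c \<and> (\<forall>A \<epsilon> T. congest \<beta> A \<longrightarrow> \<epsilon> \<le> 1/2 \<longrightarrow> solves_laplacian_within \<kappa> \<epsilon> A T \<longrightarrow>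
        (\<forall>n\<ge>n\<^sub>0. \<forall>D<n. 2 * ln (real n) \<le> real D \<longrightarrow>
           c * (sqrt (real n) + real D) / ln (real n) ^ 2 \<le> real (T n D)))"
  \<comment> \<open>240 is twice the 120 of \<open>highway_rounds\<close>, because
    \<open>D < sqrt n\<close> there; for larger \<open>D\<close> the path gives
    \<open>D \<le> 4 * T n D\<close> and thus room to spare.\<close>
  proof (rule exI[of _ "1 / (240 * B)"], rule exI[of _ 14400], intro conjI allI impI)
    show "0 < 1 / (240 * B)" using B by simp
    fix A \<epsilon> T and n D :: nat
    assume A: "congest \<beta> A" and eps: "\<epsilon> \<le> 1/2" and sol: "solves_laplacian_within \<kappa> \<epsilon> A T"
      and n: "14400 \<le> n" and Dn: "D < n" and D: "2 * ln (real n) \<le> real D"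
    have "exp 1 \<le> real n" using exp_le n by linarith
    then have ln1: "1 \<le> ln (real n)" using n by (subst ln_ge_iff) auto
    then have lnsq: "1 \<le> ln (real n) ^ 2" by simp
    have "sqrt (real n) + real D \<le> 240 * B * ln (real n) ^ 2 * T n D"
    proof (cases "real D < sqrt (real n)")
      case True
      have "sqrt (real n) \<le> 120 * B * ln (real n) ^ 2 * T n D"
        using highway_rounds[OF A sol eps \<kappa> n D True] by (simp add: B_def)
      then show ?thesis using True by linarith
    next
      case False
      have "sqrt (real (14400::nat)) \<le> sqrt (real n)" using n by (intro real_sqrt_le_mono) simp
      moreover have "sqrt (real (14400::nat)) = 120" by (rule real_sqrt_unique) auto
      ultimately have D120: "120 \<le> D" using False by linarith
      then have "D div 2 \<le> T n D + 1" using \<kappa> Dn by (intro path_rounds[OF sol eps]) auto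
      then have "D \<le> 4 * T n D" using D120 by linarith
      then have "sqrt (real n) + real D \<le> 8 * real (T n D)" using False by linarith
      also have "\<dots> \<le> (240 * (B * ln (real n) ^ 2)) * real (T n D)"
        using mult_mono[OF B lnsq] B by (intro mult_right_mono) auto
      finally show ?thesis by (simp add: mult_ac)
    qed
    moreover have "0 < 240 * B * ln (real n) ^ 2" using B lnsq by (intro mult_pos_pos) auto
    ultimately have "(sqrt (real n) + real D) / (240 * B * ln (real n) ^ 2) \<le> real (T n D)"
      by (simp only: pos_divide_le_eq mult.commute[of _ "real (T n D)"])
    then show "1 / (240 * B) * (sqrt (real n) + real D) / ln (real n) ^ 2 \<le> real (T n D)" by simp
  qed
qed

end
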